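(* Let $d\in\mathbb{N}$, $\varepsilon>0$, $y\in\mathbb{R}^d$, and let $\Phi,R,I,\hat x,\Sigma,\mu^y,\mathcal{L}_{\mu^y}$ be as in the context. Suppose that: (1) $\Phi,R\in C^3(\mathbb{R}^d,\mathbb{R})$, $I$ has a unique global minimizer $\hat x=\hat x(y)\in\mathbb{R}^d$, and $D^2I(\hat x)$ is positive definite; (2) there is a constant $K>0$ such that $\max\{\|D^3\Phi(x)\|_\Sigma,\|D^3R(x)\|_\Sigma\}\le K$ for all $x\in\mathbb{R}^d$; (3) there is $0<\delta\le 1$ such that $I(x)\ge\frac{\delta}{2}\|x-\hat x\|_\Sigma^2$ for all $x\in\mathbb{R}^d$. Let $C:=\sqrt2\,e/3$. If $K,\delta,\varepsilon,d$ satisfy $$\frac{6\delta^{3/2}}{(1+\varepsilon)\varepsilon^{1/2}K}\ \ge\ \max\left\{8d^{3/2},\ \left(8\ln\left(\frac{2}{C(1+\varepsilon)\varepsilon^{1/2}K\,\delta^{d/2}}\cdot\frac{\Gamma(\frac d2)}{\Gamma(\frac d2+\frac32)}\right)\right)^{3/2}\right\},$$ where the second entry of the maximum is read as $0$ if the logarithm is negative, then $$d_{\mathrm{TV}}(\mu^y,\mathcal{L}_{\mu^y})\le 2C(1+\varepsilon)\varepsilon^{1/2}K\,\frac{\Gamma(\frac d2+\frac32)}{\Gamma(\frac d2)}.$$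
   Context: Let $|\cdot|$ be the Euclidean norm on $\mathbb{R}^d$. Let $G:\mathbb{R}^d\to\mathbb{R}^d$ be a (possibly nonlinear) map, $y\in\mathbb{R}^d$, $\varepsilon>0$, and $R:\mathbb{R}^d\to\mathbb{R}$ such that $\exp(-R(x))$ is the Lebesgue density of a probability measure $\mu$ on $\mathbb{R}^d$ (the prior). Put $\Phi(x):=\frac12|y-G(x)|^2$ (scaled negative log-likelihood). The MAP estimate $\hat x=\hat x(y)$ is the unique minimizer of $x\mapsto\Phi(x)+\varepsilon R(x)$, and $I(x):=\Phi(x)+\varepsilon R(x)-\Phi(\hat x)-\varepsilon R(\hat x)$, so that $I\ge0$ and $I(\hat x)=0$. The posterior $\mu^y$ is the probability measure with Lebesgue density $\frac1Z\exp(-\frac1\varepsilon I(x))$, where $Z$ is the normalization constant. Put $\Sigma:=(D^2I(\hat x))^{-1}$ (inverse Hessian). The Laplace approximation is the Gaussian measure $\mathcal{L}_{\mu^y}:=\mathcal{N}(\hat x,\varepsilon\Sigma)$. For symmetric positive definite $\Sigma$, $\|x\|_\Sigma:=|\Sigma^{-1/2}x|$, and $\|D^3\Phi(x)\|_\Sigma:=\sup\{|D^3\Phi(x)(h_1,h_2,h_3)|:\|h_1\|_\Sigma,\|h_2\|_\Sigma,\|h_3\|_\Sigma\le1\}$ (similarly for $R$). Total variation distance: $d_{\mathrm{TV}}(\nu,\mu):=\sup_{A\in\mathcal{B}(\mathbb{R}^d)}|\nu(A)-\mu(A)|$. *)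

theory Defs
  imports "HOL-Probability.Probability"
begin

section \<open>Higher derivatives\<close>

definition dirderiv :: "'a::real_normed_vector \<Rightarrow> ('a \<Rightarrow> real) \<Rightarrow> 'a \<Rightarrow> real" where
  "dirderiv h f x = frechet_derivative f (at x) h"

text \<open>
  In finite dimension, \<open>x \<mapsto> Df(x)\<close> is of class \<open>C\<^sup>k\<close> (with the operator norm on the
  codomain) iff \<open>x \<mapsto> Df(x)(h)\<close> is of class \<open>C\<^sup>k\<close> for every direction \<open>h\<close>;
  this gives the recursion.
\<close>

fun C_class :: "nat \<Rightarrow> ('a::euclidean_space \<Rightarrow> real) \<Rightarrow> bool" where
  "C_class 0 f \<longleftrightarrow> continuous_on UNIV f"
| "C_class (Suc k) f \<longleftrightarrow> (\<forall>x. f differentiable (at x)) \<and> (\<forall>h. C_class k (dirderiv h f))"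

text \<open>
  The second and third derivatives as multilinear forms. They are meaningful for functions
  of class \<open>C\<^sup>2\<close> and \<open>C\<^sup>3\<close>, for which they are symmetric, so that the order in which
  the directions are consumed does not matter.
\<close>

definition D2 :: "('a::euclidean_space \<Rightarrow> real) \<Rightarrow> 'a \<Rightarrow> 'a \<Rightarrow> 'a \<Rightarrow> real" where
  "D2 f x h1 h2 = dirderiv h1 (dirderiv h2 f) x"

definition D3 :: "('a::euclidean_space \<Rightarrow> real) \<Rightarrow> 'a \<Rightarrow> 'a \<Rightarrow> 'a \<Rightarrow> 'a \<Rightarrow> real" where
  "D3 f x h1 h2 h3 = dirderiv h1 (dirderiv h2 (dirderiv h3 f)) x"

definition hessian :: "(real ^ 'n \<Rightarrow> real) \<Rightarrow> real ^ 'n \<Rightarrow> real ^ 'n ^ 'n" where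
  "hessian f x = (\<chi> i j. D2 f x (axis i 1) (axis j 1))"


section \<open>Positive definite matrices and weighted norms\<close>

definition pos_semidef :: "real ^ 'n ^ 'n \<Rightarrow> bool" where
  "pos_semidef A \<longleftrightarrow> transpose A = A \<and> (\<forall>x. 0 \<le> x \<bullet> (A *v x))"

definition pos_def :: "real ^ 'n ^ 'n \<Rightarrow> bool" where
  "pos_def A \<longleftrightarrow> transpose A = A \<and> (\<forall>x. x \<noteq> 0 \<longrightarrow> 0 < x \<bullet> (A *v x))"

text \<open>
  The principal square root. It exists and is unique for positive semidefinite \<open>A\<close>, and
  is unspecified otherwise.
\<close>

definition matrix_sqrt :: "real ^ 'n ^ 'n \<Rightarrow> real ^ 'n ^ 'n" where
  "matrix_sqrt A = (THE B. pos_semidef B \<and> B ** B = A)"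

definition wnorm :: "real ^ 'n ^ 'n \<Rightarrow> real ^ 'n \<Rightarrow> real" where
  "wnorm \<Sigma> x = norm (matrix_inv (matrix_sqrt \<Sigma>) *v x)"

text \<open>
  The supremum below is a supremum of reals; the set is nonempty, and for \<open>f\<close> of class
  \<open>C\<^sup>3\<close> and positive definite \<open>\<Sigma>\<close> it is bounded.
\<close>

definition D3_norm :: "real ^ 'n ^ 'n \<Rightarrow> (real ^ 'n \<Rightarrow> real) \<Rightarrow> real ^ 'n \<Rightarrow> real" where
  "D3_norm \<Sigma> f x =
     Sup {\<bar>D3 f x h1 h2 h3\<bar> | h1 h2 h3. wnorm \<Sigma> h1 \<le> 1 \<and> wnorm \<Sigma> h2 \<le> 1 \<and> wnorm \<Sigma> h3 \<le> 1}"


section \<open>Probability measures\<close>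

text \<open>The Gaussian measure with mean \<open>m\<close> and positive definite covariance matrix \<open>A\<close>.\<close>

definition gaussian_measure :: "real ^ 'n \<Rightarrow> real ^ 'n ^ 'n \<Rightarrow> (real ^ 'n) measure" where
  "gaussian_measure m A = density lborel (\<lambda>x. ennreal
     (exp (- (1/2) * ((x - m) \<bullet> (matrix_inv A *v (x - m)))) / sqrt ((2 * pi) ^ CARD('n) * det A)))"

definition tv_dist :: "'a::topological_space measure \<Rightarrow> 'a measure \<Rightarrow> real" where
  "tv_dist \<nu> \<mu> = (SUP A\<in>sets borel. \<bar>measure \<nu> A - measure \<mu> A\<bar>)"


section \<open>The Bayesian inverse problem\<close>

definition unique_minimizer :: "('a \<Rightarrow> real) \<Rightarrow> 'a \<Rightarrow> bool" where
  "unique_minimizer f x \<longleftrightarrow> (\<forall>z. z \<noteq> x \<longrightarrow> f x < f z)"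

definition prior :: "(real ^ 'n \<Rightarrow> real) \<Rightarrow> (real ^ 'n) measure" where
  "prior R = density lborel (\<lambda>x. ennreal (exp (- R x)))"

definition misfit :: "(real ^ 'n \<Rightarrow> real ^ 'n) \<Rightarrow> real ^ 'n \<Rightarrow> real ^ 'n \<Rightarrow> real" where
  "misfit G y x = 1/2 * (norm (y - G x))\<^sup>2"

definition is_map_estimate ::
  "(real ^ 'n \<Rightarrow> real) \<Rightarrow> (real ^ 'n \<Rightarrow> real) \<Rightarrow> real \<Rightarrow> real ^ 'n \<Rightarrow> bool" where
  "is_map_estimate \<Phi> R \<epsilon> xhat \<longleftrightarrow> unique_minimizer (\<lambda>x. \<Phi> x + \<epsilon> * R x) xhat"

definition rate_fun ::
  "(real ^ 'n \<Rightarrow> real) \<Rightarrow> (real ^ 'n \<Rightarrow> real) \<Rightarrow> real \<Rightarrow> real ^ 'n \<Rightarrow> real ^ 'n \<Rightarrow> real" where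
  "rate_fun \<Phi> R \<epsilon> xhat x = \<Phi> x + \<epsilon> * R x - \<Phi> xhat - \<epsilon> * R xhat"

definition posterior :: "(real ^ 'n \<Rightarrow> real) \<Rightarrow> real \<Rightarrow> (real ^ 'n) measure" where
  "posterior I \<epsilon> =
     (let Z = (LINT x|lborel. exp (- (1 / \<epsilon>) * I x))
      in density lborel (\<lambda>x. ennreal (1 / Z * exp (- (1 / \<epsilon>) * I x))))"

definition laplace_cov :: "(real ^ 'n \<Rightarrow> real) \<Rightarrow> real ^ 'n \<Rightarrow> real ^ 'n ^ 'n" where
  "laplace_cov I xhat = matrix_inv (hessian I xhat)"

definition laplace_approx ::
  "(real ^ 'n \<Rightarrow> real) \<Rightarrow> real \<Rightarrow> real ^ 'n \<Rightarrow> (real ^ 'n) measure" where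
  "laplace_approx I \<epsilon> xhat = gaussian_measure xhat (\<epsilon> *\<^sub>R laplace_cov I xhat)"

end

theory Submission
  imports Defs
begin

text \<open>
  Write \<open>u = exp (- I / \<epsilon>)\<close> for the unnormalized posterior density, \<open>w\<close> for the distance to the
  minimizer in the norm of \<open>\<epsilon> \<Sigma>\<close>, \<open>g = exp (- w\<^sup>2 / 2)\<close> for the unnormalized Gaussian density, and
  \<open>W\<close> for the integral of \<open>g\<close>. Normalizing both densities costs at most a factor \<open>2\<close> in \<open>L\<^sup>1\<close>, which
  cancels the factor \<open>1/2\<close> between \<open>L\<^sup>1\<close> distance and total variation, so the total variation
  distance is at most the integral of \<open>\<bar>u - g\<bar>\<close> divided by \<open>W\<close>.

  With \<open>\<kappa> = (1 + \<epsilon>) \<epsilon>\<^sup>1\<^sup>/\<^sup>2 K\<close>, Taylor's theorem along segments gives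
  \<open>\<bar>I / \<epsilon> - w\<^sup>2 / 2\<bar> \<le> \<kappa> w\<^sup>3 / 6\<close>. Where the right-hand side is at most \<open>1\<close>, we get
  \<open>\<bar>u - g\<bar> \<le> e \<kappa> w\<^sup>3 g / 6\<close>, whose integral is a third absolute Gaussian moment. Elsewhere both \<open>u\<close>
  and \<open>g\<close> are at most \<open>exp (- \<delta> w\<^sup>2 / 2)\<close>; one half of the exponent is bounded by its value on the
  boundary of the region and the other half is integrated. The hypothesis on \<open>K, \<delta>, \<epsilon>, d\<close> makes the second
  contribution no larger than the first.
\<close>

section \<open>Positive definite matrices\<close>

lemma dot_matrix_vector_mult:
  fixes A :: "real ^ 'n ^ 'm"
  shows "x \<bullet> (A *v y) = (transpose A *v x) \<bullet> y"
  by (simp add: dot_lmul_matrix vector_transpose_matrix)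

text \<open>Moving \<open>v\<close> along its residual \<open>w = A v - l v\<close>, which lies in
  \<open>S\<close> by invariance, changes the quadratic form to first order by
  \<open>2 t (w \<bullet> w)\<close>, while the squared norm changes only to second order.
  Maximality for small \<open>t > 0\<close> forces \<open>w = 0\<close>.\<close>

lemma Rayleigh_maximizer_eigenvector:
  fixes A :: "real ^ 'n ^ 'n"
  assumes A: "transpose A = A" and S: "subspace S" "\<And>x. x \<in> S \<Longrightarrow> A *v x \<in> S"
    and v: "v \<in> S" "norm v = 1"
    and max: "\<And>x. x \<in> S \<Longrightarrow> norm x = 1 \<Longrightarrow> x \<bullet> (A *v x) \<le> v \<bullet> (A *v v)"
  shows "A *v v = (v \<bullet> (A *v v)) *\<^sub>R v"
proof -
  define l where "l = v \<bullet> (A *v v)"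
  define w where "w = A *v v - l *\<^sub>R v"
  have wS: "w \<in> S"
    using S v by (simp add: w_def subspace_diff subspace_scale)
  have vv: "v \<bullet> v = 1" using v by (simp add: dot_square_norm)
  have vw: "v \<bullet> w = 0" by (simp add: w_def inner_diff_right l_def vv)
  \<comment> \<open>Homogeneity extends the bound from unit vectors to all of \<open>S\<close>, so
    the perturbed vector need not be normalized.\<close>
  have le: "u \<bullet> (A *v u) \<le> l * (u \<bullet> u)" if "u \<in> S" for u
  proof (cases "u = 0")
    case False
    define x where "x = (1 / norm u) *\<^sub>R u"
    have "x \<bullet> (A *v x) \<le> l"
      unfolding l_def using False that by (intro max) (auto simp: x_def S(1) subspace_scale)
    then have "(u \<bullet> (A *v u)) / (norm u * norm u) \<le> l"
      by (simp add: x_def matrix_vector_mult_scaleR)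
    then show ?thesis
      using False by (simp add: field_simps dot_square_norm power2_eq_square)
  qed simp
  have Awv: "w \<bullet> (A *v v) = w \<bullet> w"
  proof -
    have "A *v v = w + l *\<^sub>R v" by (simp add: w_def)
    then show ?thesis using vw by (simp add: inner_right_distrib inner_commute)
  qed
  have Avw: "v \<bullet> (A *v w) = w \<bullet> w"
    using Awv A by (metis dot_matrix_vector_mult inner_commute)
  have quad: "2 * t * (w \<bullet> w) \<le> t\<^sup>2 * (l * (w \<bullet> w) - w \<bullet> (A *v w))" for t
  proof -
    have 1: "(v + t *\<^sub>R w) \<bullet> (A *v (v + t *\<^sub>R w)) \<le> l * ((v + t *\<^sub>R w) \<bullet> (v + t *\<^sub>R w))"
      using S(1) v wS by (intro le) (simp add: subspace_add subspace_scale)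
    have 2: "(v + t *\<^sub>R w) \<bullet> (A *v (v + t *\<^sub>R w)) = l + 2 * t * (w \<bullet> w) + t\<^sup>2 * (w \<bullet> (A *v w))"
      by (simp add: matrix_vector_right_distrib matrix_vector_mult_scaleR inner_add_left
          inner_add_right Avw Awv l_def power2_eq_square algebra_simps)
    have 3: "(v + t *\<^sub>R w) \<bullet> (v + t *\<^sub>R w) = 1 + t\<^sup>2 * (w \<bullet> w)"
      using vv vw by (simp add: inner_add_left inner_add_right inner_commute power2_eq_square)
    show ?thesis using 1 unfolding 2 3 by (simp add: algebra_simps)
  qed
  have "w \<bullet> w = 0"
  proof (rule ccontr)
    assume "w \<bullet> w \<noteq> 0"
    then have p: "w \<bullet> w > 0" using inner_ge_zero[of w] by linarith
    define a where "a = w \<bullet> w"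
    \<comment> \<open>\<open>c\<close> is positive and dominates the second-order coefficient; at
      \<open>t = a / c\<close> the linear term is twice the bound for the quadratic one.\<close>
    define c where "c = \<bar>l * (w \<bullet> w) - w \<bullet> (A *v w)\<bar> + 1"
    have c: "c > 0" "l * (w \<bullet> w) - w \<bullet> (A *v w) \<le> c" by (auto simp: c_def)
    have "2 * (a / c) * a \<le> (a / c)\<^sup>2 * (l * (w \<bullet> w) - w \<bullet> (A *v w))"
      using quad[of "a / c"] by (simp only: a_def)
    also have "\<dots> \<le> (a / c)\<^sup>2 * c"
      by (rule mult_left_mono[OF c(2)]) simp
    finally have "2 * (a / c) * a \<le> (a / c)\<^sup>2 * c" .
    then have "2 * (a * a) \<le> a * a"
      using c(1) by (simp add: power2_eq_square field_simps)
    moreover have "a * a > 0" using p by (simp add: a_def)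
    ultimately show False by linarith
  qed
  then show ?thesis by (simp add: w_def l_def)
qed

text \<open>Maximal orthonormal systems of eigenvectors span: otherwise the Rayleigh quotient has a
  maximizer on the invariant orthogonal complement.\<close>

lemma symmetric_matrix_orthonormal_eigenbasis:
  fixes A :: "real ^ 'n ^ 'n"
  assumes A: "transpose A = A"
  shows "\<exists>B. pairwise orthogonal B \<and> card B = CARD('n) \<and> finite B \<and>
    (\<forall>v\<in>B. norm v = 1 \<and> A *v v = (v \<bullet> (A *v v)) *\<^sub>R v)"
proof -
  define P where "P = (\<lambda>B. pairwise orthogonal B \<and>
    (\<forall>v\<in>B. norm v = 1 \<and> A *v v = (v \<bullet> (A *v v)) *\<^sub>R v))"
  have ind: "independent B" if "P B" for B
    using that by (intro pairwise_orthogonal_independent) (auto simp: P_def)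
  have card_le: "finite B \<and> card B \<le> CARD('n)" if "P B" for B
    using independent_bound[OF ind[OF that]] by simp
  have "P {}" by (simp add: P_def)
  moreover have "\<forall>B. P B \<longrightarrow> card B < Suc CARD('n)" using card_le by (simp add: less_Suc_eq_le)
  ultimately have "\<exists>B. P B \<and> (\<forall>B'. P B' \<longrightarrow> card B' \<le> card B)"
    by (rule ex_has_greatest_nat)
  then obtain B where B: "P B" and Bmax: "\<And>B'. P B' \<Longrightarrow> card B' \<le> card B"
    by blast
  define S where "S = {x. \<forall>v\<in>B. orthogonal v x}"
  have S: "subspace S"
    unfolding S_def using subspace_orthogonal_to_vectors[of B] by (simp add: orthogonal_commute)
  have AS: "A *v x \<in> S" if "x \<in> S" for x
    unfolding S_def
  proof (intro CollectI ballI)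
    fix v assume v: "v \<in> B"
    have "v \<bullet> (A *v x) = (A *v v) \<bullet> x" by (simp add: dot_matrix_vector_mult A)
    also have "A *v v = (v \<bullet> (A *v v)) *\<^sub>R v" using B v by (auto simp: P_def)
    also have "(v \<bullet> (A *v v)) *\<^sub>R v \<bullet> x = 0"
      using that v by (simp add: S_def orthogonal_def)
    finally show "orthogonal v (A *v x)" by (simp add: orthogonal_def)
  qed
  have "card B = CARD('n)"
  proof (rule ccontr)
    assume "card B \<noteq> CARD('n)"
    then have lt: "card B < CARD('n)" using conjunct2[OF card_le[OF B]] le_neq_implies_less by blast
    have "dim B < DIM(real ^ 'n)"
      using lt by (subst dim_eq_card_independent[OF ind[OF B]]) simp
    then obtain u where u: "u \<noteq> 0" "\<And>x. x \<in> span B \<Longrightarrow> orthogonal u x"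
      by (rule orthogonal_to_subspace_exists) (rule that)
    let ?C = "S \<inter> sphere 0 1"
    have "(1 / norm u) *\<^sub>R u \<in> ?C"
      using u by (simp add: S_def span_base orthogonal_def inner_commute)
    then have ne: "?C \<noteq> {}" by blast
    have "compact ?C"
      using closed_subspace[OF S] by (simp add: closed_Int_compact)
    moreover have "continuous_on ?C (\<lambda>x. x \<bullet> (A *v x))"
      by (intro continuous_intros matrix_vector_mult_linear_continuous_on)
    ultimately obtain v where v: "v \<in> ?C" "\<And>x. x \<in> ?C \<Longrightarrow> x \<bullet> (A *v x) \<le> v \<bullet> (A *v v)"
      using continuous_attains_sup[of ?C "\<lambda>x. x \<bullet> (A *v x)"] ne by blast
    have "A *v v = (v \<bullet> (A *v v)) *\<^sub>R v"
      by (rule Rayleigh_maximizer_eigenvector[OF A S AS]) (use v in auto)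
    then have "P (insert v B)"
      using B v(1) by (auto simp: P_def pairwise_insert S_def orthogonal_commute)
    moreover have "v \<notin> B"
    proof
      assume "v \<in> B"
      then have "v \<bullet> v = 0" using v(1) by (simp add: S_def orthogonal_def)
      then show False using v(1) by simp
    qed
    ultimately show False
      using Bmax[of "insert v B"] card_le[OF B] by simp
  qed
  then show ?thesis using B card_le[OF B] by (auto simp: P_def)
qed

section \<open>Spectral theorem in matrix form\<close>

definition diag_mat :: "('n \<Rightarrow> real) \<Rightarrow> real ^ 'n ^ 'n" where
  "diag_mat l = (\<chi> i j. if i = j then l i else 0)"

lemma diag_mat_mult_vector: "diag_mat l *v x = (\<chi> i. l i * x $ i)"
  by (simp add: diag_mat_def matrix_vector_mult_def vec_eq_iff if_distrib[of "\<lambda>c. c * _"] cong: if_cong)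

lemma diag_mat_mult: "diag_mat l ** diag_mat m = diag_mat (\<lambda>i. l i * m i)"
  by (rule matrix_eq[THEN iffD2])
     (simp add: matrix_vector_mul_assoc[symmetric] diag_mat_mult_vector mult_ac)

lemma transpose_diag_mat [simp]: "transpose (diag_mat l) = diag_mat l"
  by (simp add: diag_mat_def transpose_def vec_eq_iff)

lemma det_diag_mat: "det (diag_mat l) = (\<Prod>i\<in>UNIV. l i)"
  by (subst det_diagonal) (auto simp: diag_mat_def)

text \<open>The columns of \<open>Q\<close> are the orthonormal eigenvectors, enumerated by an
  arbitrary bijection from the index type.\<close>

theorem symmetric_matrix_diagonalizable:
  fixes A :: "real ^ 'n ^ 'n"
  assumes A: "transpose A = A"
  obtains Q l where "orthogonal_matrix Q" "A = Q ** diag_mat l ** transpose Q"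
proof -
  obtain B where B: "pairwise orthogonal B" "card B = CARD('n)" "finite B"
    "\<And>v. v \<in> B \<Longrightarrow> norm v = 1" "\<And>v. v \<in> B \<Longrightarrow> A *v v = (v \<bullet> (A *v v)) *\<^sub>R v"
    using symmetric_matrix_orthonormal_eigenbasis[OF A] by blast
  obtain f :: "'n \<Rightarrow> real ^ 'n" where f: "bij_betw f UNIV B"
    using B(2,3) finite_same_card_bij[of "UNIV :: 'n set" B] by auto
  then have fB: "f i \<in> B" for i by (auto simp: bij_betw_def)
  define Q where "Q = (\<chi> i j. f j $ i)"
  define l where "l = (\<lambda>i. f i \<bullet> (A *v f i))"
  have col: "column i Q = f i" for i
    by (simp add: column_def Q_def)
  have orth: "orthogonal_matrix Q"
    unfolding orthogonal_matrix_orthonormal_columns col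
  proof (intro conjI allI impI)
    fix i j :: 'n assume "i \<noteq> j"
    then have "f i \<noteq> f j" using f by (auto simp: bij_betw_def inj_def)
    then show "orthogonal (f i) (f j)" using B(1) fB by (auto simp: pairwise_def)
  qed (use fB B(4) in auto)
  have "A ** Q = Q ** diag_mat l"
  proof -
    have "(A ** Q) $ i $ j = (Q ** diag_mat l) $ i $ j" for i j
    proof -
      have "(A ** Q) $ i $ j = (A *v f j) $ i"
        by (simp add: matrix_matrix_mult_def matrix_vector_mult_def Q_def)
      also have "\<dots> = l j * f j $ i"
        using arg_cong[OF B(5)[OF fB[of j]], of "\<lambda>x. x $ i"] by (simp only: l_def vector_scaleR_component real_scaleR_def)
      also have "\<dots> = (Q ** diag_mat l) $ i $ j"
        by (simp add: matrix_matrix_mult_def Q_def diag_mat_def if_distrib[of "\<lambda>c. _ * c"] cong: if_cong)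
      finally show ?thesis .
    qed
    then show ?thesis by (simp add: vec_eq_iff)
  qed
  moreover have "Q ** transpose Q = mat 1"
    using orth by (simp add: orthogonal_matrix_def)
  ultimately have "A = Q ** diag_mat l ** transpose Q"
    by (metis matrix_mul_assoc[of A Q] matrix_mul_rid)
  with orth show ?thesis by (rule that)
qed

lemma transpose_mult_diag_mat_transpose:
  "transpose (Q ** diag_mat l ** transpose Q) = Q ** diag_mat l ** transpose Q"
  by (simp add: matrix_transpose_mul matrix_mul_assoc)

lemma orthogonal_diag_mult:
  assumes "orthogonal_matrix Q"
  shows "(Q ** diag_mat l ** transpose Q) ** (Q ** diag_mat m ** transpose Q) =
    Q ** diag_mat (\<lambda>i. l i * m i) ** transpose Q"
proof -
  have "(Q ** diag_mat l ** transpose Q) ** (Q ** diag_mat m ** transpose Q) =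
      Q ** diag_mat l ** (transpose Q ** Q) ** diag_mat m ** transpose Q"
    by (simp add: matrix_mul_assoc)
  also have "\<dots> = Q ** (diag_mat l ** diag_mat m) ** transpose Q"
    using assms by (simp add: orthogonal_matrix_def matrix_mul_assoc)
  finally show ?thesis by (simp add: diag_mat_mult)
qed

lemma orthogonal_diag_eq_1:
  assumes "orthogonal_matrix Q" and "\<And>i. l i = 1"
  shows "Q ** diag_mat l ** transpose Q = mat 1"
proof -
  have "diag_mat l = mat 1" using assms(2) by (simp add: diag_mat_def mat_def vec_eq_iff)
  then show ?thesis using assms(1) by (simp add: orthogonal_matrix_def)
qed

lemma orthogonal_diag_mult_column:
  assumes "orthogonal_matrix Q"
  shows "(Q ** diag_mat l ** transpose Q) *v (Q *v axis i 1) = l i *\<^sub>R (Q *v axis i 1)"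
proof -
  have "(Q ** diag_mat l ** transpose Q) *v (Q *v axis i 1) = Q *v (diag_mat l *v (transpose Q ** Q *v axis i 1))"
    by (simp add: matrix_vector_mul_assoc matrix_mul_assoc)
  also have "\<dots> = Q *v (diag_mat l *v axis i 1)"
    using assms by (simp add: orthogonal_matrix_def)
  also have "diag_mat l *v axis i 1 = l i *\<^sub>R axis i 1"
    by (simp add: diag_mat_mult_vector axis_def vec_eq_iff)
  finally show ?thesis by (simp add: matrix_vector_mult_scaleR)
qed

lemma orthogonal_diag_quadratic_form:
  "x \<bullet> ((Q ** diag_mat l ** transpose Q) *v x) = (\<Sum>i\<in>UNIV. l i * ((transpose Q *v x) $ i)\<^sup>2)"
proof -
  have "x \<bullet> ((Q ** diag_mat l ** transpose Q) *v x) = x \<bullet> (Q *v (diag_mat l *v (transpose Q *v x)))"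
    by (simp add: matrix_vector_mul_assoc matrix_mul_assoc del: transpose_matrix_vector)
  also have "\<dots> = (transpose Q *v x) \<bullet> (diag_mat l *v (transpose Q *v x))"
    by (rule dot_matrix_vector_mult)
  finally show ?thesis
    by (simp add: inner_vec_def diag_mat_mult_vector power2_eq_square mult_ac)
qed

text \<open>The columns of \<open>Q\<close> form a basis. This reduces the uniqueness of the square
  root to a check on eigenvectors.\<close>

lemma matrix_eq_on_orthogonal_columns:
  assumes Q: "orthogonal_matrix Q" and eq: "\<And>i. A *v (Q *v axis i 1) = B *v (Q *v axis i 1)"
  shows "A = (B :: real ^ 'n ^ 'n)"
proof -
  have "(A ** Q) *v axis i 1 = (B ** Q) *v axis i 1" for i
    using eq[of i] by (simp add: matrix_vector_mul_assoc)
  then have "column i (A ** Q) = column i (B ** Q)" for i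
    by (simp add: matrix_vector_mult_basis)
  then have "A ** Q = B ** Q"
    by (simp add: column_def vec_eq_iff)
  then have "A ** (Q ** transpose Q) = B ** (Q ** transpose Q)"
    by (simp add: matrix_mul_assoc)
  then show ?thesis using Q by (simp add: orthogonal_matrix_def)
qed

text \<open>\<open>matrix_inv\<close> is a choice among two-sided inverses. For square matrices a
  right inverse is two-sided and two-sided inverses are unique, so the choice can only be
  \<open>B\<close>.\<close>

lemma matrix_inv_eqI:
  fixes A :: "real ^ 'n ^ 'n"
  assumes "A ** B = mat 1"
  shows "matrix_inv A = B"
proof -
  have BA: "B ** A = mat 1" using assms matrix_left_right_inverse by blast
  have "A ** matrix_inv A = mat 1 \<and> matrix_inv A ** A = mat 1"
    unfolding matrix_inv_def by (rule someI[of _ B]) (use assms BA in auto)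
  then have "matrix_inv A = (B ** A) ** matrix_inv A" using BA by simp
  also have "\<dots> = B" by (simp add: matrix_mul_assoc[symmetric] \<open>A ** matrix_inv A = mat 1 \<and> _\<close>)
  finally show ?thesis .
qed

text \<open>Each eigenvalue is the value of the quadratic form at a unit column of
  \<open>Q\<close>.\<close>

lemma pos_def_diagonalization:
  fixes H :: "real ^ 'n ^ 'n"
  assumes H: "pos_def H"
  obtains Q l where "orthogonal_matrix Q" "H = Q ** diag_mat l ** transpose Q" "\<And>i. l i > 0"
proof -
  have sym: "transpose H = H" using H by (simp add: pos_def_def)
  obtain Q l where Q: "orthogonal_matrix Q" and Hd: "H = Q ** diag_mat l ** transpose Q"
    using symmetric_matrix_diagonalizable[OF sym] by metis
  have "l i > 0" for i
  proof -
    let ?v = "Q *v axis i (1::real)"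
    have nv: "norm ?v = 1"
      using Q orthogonal_transformation_matrix[of "(*v) Q"] orthogonal_transformation_norm[of "(*v) Q"]
      by (simp add: matrix_vector_mul_linear)
    then have "?v \<noteq> 0" by auto
    then have "0 < ?v \<bullet> (H *v ?v)" using H by (simp add: pos_def_def)
    also have "?v \<bullet> (H *v ?v) = l i"
      unfolding Hd orthogonal_diag_mult_column[OF Q] using nv by (simp add: dot_square_norm)
    finally show ?thesis .
  qed
  with Q Hd show ?thesis by (rule that)
qed

lemma det_orthogonal_diag:
  assumes "orthogonal_matrix Q"
  shows "det (Q ** diag_mat l ** transpose Q) = (\<Prod>i\<in>UNIV. l i)"
proof -
  have "det Q * det Q = 1"
    using det_orthogonal_matrix[OF assms] by auto
  then show ?thesis
    by (simp add: det_mul det_diag_mat mult_ac)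
qed

lemma pos_def_det:
  fixes H :: "real ^ 'n ^ 'n"
  assumes "pos_def H"
  shows "det H > 0"
proof -
  obtain Q l where "orthogonal_matrix Q" "H = Q ** diag_mat l ** transpose Q" "\<And>i. l i > 0"
    using pos_def_diagonalization[OF assms] by metis
  then show ?thesis by (simp add: det_orthogonal_diag prod_pos)
qed

section \<open>Inverses, square roots and the weighted norm\<close>

lemma pos_def_scaleR: "pos_def H \<Longrightarrow> c > 0 \<Longrightarrow> pos_def (c *\<^sub>R H)"
  by (auto simp: pos_def_def transpose_scalar scaleR_matrix_vector_assoc[symmetric])

lemma matrix_inv_scaleR:
  fixes H :: "real ^ 'n ^ 'n"
  assumes "pos_def H" "c \<noteq> 0"
  shows "matrix_inv (c *\<^sub>R H) = (1 / c) *\<^sub>R matrix_inv H"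
proof (rule matrix_inv_eqI)
  have "det H > 0" by (rule pos_def_det[OF assms(1)])
  then obtain B where B: "H ** B = mat 1"
    using invertible_det_nz[of H] by (auto simp: invertible_def)
  then show "(c *\<^sub>R H) ** ((1 / c) *\<^sub>R matrix_inv H) = mat 1"
    using assms(2) by (simp add: matrix_inv_eqI scalar_matrix_assoc[symmetric] matrix_scalar_ac)
qed

text \<open>A positive semidefinite square root of a positive definite matrix acts on each eigenvector
  as the root of its eigenvalue: for \<open>u = B v - s v\<close> one has \<open>B u = - s u\<close>, forcing \<open>u = 0\<close>.\<close>

lemma matrix_sqrt_orthogonal_diag:
  assumes Q: "orthogonal_matrix Q" and l: "\<And>i. l i > 0"
  shows "matrix_sqrt (Q ** diag_mat l ** transpose Q) = Q ** diag_mat (\<lambda>i. sqrt (l i)) ** transpose Q"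
proof -
  let ?S = "Q ** diag_mat (\<lambda>i. sqrt (l i)) ** transpose Q"
  have ll: "(\<lambda>i. sqrt (l i) * sqrt (l i)) = l" using l by (auto simp: less_imp_le)
  have SS: "?S ** ?S = Q ** diag_mat l ** transpose Q"
    unfolding orthogonal_diag_mult[OF Q] ll ..
  have psd: "pos_semidef ?S"
    using l by (auto simp: pos_semidef_def transpose_mult_diag_mat_transpose
        orthogonal_diag_quadratic_form less_imp_le intro!: sum_nonneg)
  have uniq: "B = ?S" if B: "pos_semidef B" "B ** B = Q ** diag_mat l ** transpose Q" for B
  proof (rule matrix_eq_on_orthogonal_columns[OF Q])
    fix i
    let ?v = "Q *v axis i (1::real)"
    define s where "s = sqrt (l i)"
    have s: "s > 0" "s * s = l i" using l[of i] by (auto simp: s_def)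
    define u where "u = B *v ?v - s *\<^sub>R ?v"
    have "B *v (B *v ?v) = (s * s) *\<^sub>R ?v"
      unfolding matrix_vector_mul_assoc[of B B] B(2) s(2) by (rule orthogonal_diag_mult_column[OF Q])
    then have "B *v u = - s *\<^sub>R u"
      by (simp add: u_def matrix_vector_mult_diff_distrib matrix_vector_mult_scaleR scaleR_diff_right)
    moreover have "0 \<le> u \<bullet> (B *v u)" using B(1) by (simp add: pos_semidef_def)
    ultimately have "s * (u \<bullet> u) \<le> 0" by simp
    then have "u \<bullet> u \<le> 0" using s(1) by (simp add: mult_le_0_iff)
    then have "u = 0" using inner_ge_zero[of u] by (simp add: antisym)
    then show "B *v ?v = ?S *v ?v"
      unfolding orthogonal_diag_mult_column[OF Q] by (simp add: u_def s_def)
  qed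
  show ?thesis
    unfolding matrix_sqrt_def
  proof (rule the_equality)
    show "pos_semidef ?S \<and> ?S ** ?S = Q ** diag_mat l ** transpose Q"
      using psd SS by (rule conjI)
  qed (elim conjE, rule uniq)
qed

lemma matrix_inv_orthogonal_diag:
  assumes Q: "orthogonal_matrix Q" and l: "\<And>i. l i > 0"
  shows "matrix_inv (Q ** diag_mat l ** transpose Q) = Q ** diag_mat (\<lambda>i. 1 / l i) ** transpose Q"
  by (rule matrix_inv_eqI, subst orthogonal_diag_mult[OF Q], rule orthogonal_diag_eq_1[OF Q])
     (use l in \<open>simp add: less_imp_neq[symmetric]\<close>)

text \<open>In the eigenbasis of \<open>H\<close>, the inverse square root of the inverse of
  \<open>H\<close> is the square root \<open>N\<close> of \<open>H\<close>. The identity links the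
  weighted norm of the hypotheses to the Hessian in the Gaussian exponent.\<close>

lemma wnorm_matrix_inv_sq:
  fixes H :: "real ^ 'n ^ 'n"
  assumes H: "pos_def H"
  shows "(wnorm (matrix_inv H) x)\<^sup>2 = x \<bullet> (H *v x)"
proof -
  obtain Q l where Q: "orthogonal_matrix Q" and Hd: "H = Q ** diag_mat l ** transpose Q"
    and l: "\<And>i. l i > 0"
    using pos_def_diagonalization[OF H] by metis
  define N where "N = Q ** diag_mat (\<lambda>i. sqrt (l i)) ** transpose Q"
  have "matrix_inv (matrix_sqrt (matrix_inv H)) = N"
    using l unfolding Hd N_def
    by (simp add: matrix_inv_orthogonal_diag[OF Q] matrix_sqrt_orthogonal_diag[OF Q] real_sqrt_divide)
  then have "(wnorm (matrix_inv H) x)\<^sup>2 = (N *v x) \<bullet> (N *v x)"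
    by (simp add: wnorm_def dot_square_norm)
  also have "\<dots> = (transpose N *v x) \<bullet> (N *v x)"
    by (simp add: N_def transpose_mult_diag_mat_transpose)
  also have "\<dots> = x \<bullet> ((N ** N) *v x)"
    by (simp add: dot_matrix_vector_mult[symmetric] matrix_vector_mul_assoc del: transpose_matrix_vector)
  also have "N ** N = H"
    using l by (simp add: N_def orthogonal_diag_mult[OF Q] Hd less_imp_le)
  finally show ?thesis .
qed

lemma wnorm_nonneg: "0 \<le> wnorm S x"
  by (simp add: wnorm_def)

lemma wnorm_scaleR: "wnorm S (c *\<^sub>R x) = \<bar>c\<bar> * wnorm S x"
  by (simp add: wnorm_def matrix_vector_mult_scaleR)

text \<open>\<open>M\<close> is one over the square root of the smallest eigenvalue of
  \<open>H\<close>. It makes the weighted unit ball bounded in the Euclidean norm, which the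
  supremum in \<open>D3_norm\<close> requires.\<close>

lemma wnorm_matrix_inv_lower_bound:
  fixes H :: "real ^ 'n ^ 'n"
  assumes H: "pos_def H"
  obtains M where "\<And>x. norm x \<le> M * wnorm (matrix_inv H) x" "M > 0"
proof -
  obtain Q l where Q: "orthogonal_matrix Q" and Hd: "H = Q ** diag_mat l ** transpose Q"
    and l: "\<And>i. l i > 0"
    using pos_def_diagonalization[OF H] by metis
  define m where "m = Min (range l)"
  have m: "m > 0" "\<And>i. m \<le> l i" using l by (auto simp: m_def)
  have "norm x \<le> 1 / sqrt m * wnorm (matrix_inv H) x" for x
  proof -
    have nQ: "norm (transpose Q *v x) = norm x"
      using Q orthogonal_transformation_matrix[of "(*v) (transpose Q)"]
        orthogonal_transformation_norm[of "(*v) (transpose Q)"]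
      by (simp add: matrix_vector_mul_linear)
    have "m * (norm x)\<^sup>2 = (\<Sum>i\<in>UNIV. m * ((transpose Q *v x) $ i)\<^sup>2)"
      unfolding nQ[symmetric] by (simp add: norm_vec_def L2_set_def sum_nonneg sum_distrib_left)
    also have "\<dots> \<le> (wnorm (matrix_inv H) x)\<^sup>2"
      unfolding wnorm_matrix_inv_sq[OF H] unfolding Hd orthogonal_diag_quadratic_form
      by (intro sum_mono mult_right_mono m) simp
    finally have "sqrt (m * (norm x)\<^sup>2) \<le> sqrt ((wnorm (matrix_inv H) x)\<^sup>2)"
      by (rule real_sqrt_le_mono)
    then show ?thesis using m by (simp add: real_sqrt_mult wnorm_def field_simps)
  qed
  then show ?thesis using m by (intro that[of "1 / sqrt m"]) auto
qed


section \<open>Gaussian integrals\<close>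

lemma nn_integral_lborel_translate:
  fixes f :: "'a::euclidean_space \<Rightarrow> ennreal"
  assumes [measurable]: "f \<in> borel_measurable borel"
  shows "(\<integral>\<^sup>+x. f (t + x) \<partial>lborel) = (\<integral>\<^sup>+x. f x \<partial>lborel)"
proof -
  have "(\<integral>\<^sup>+x. f x \<partial>lborel) = (\<integral>\<^sup>+x. f x \<partial>distr lborel borel ((+) t))"
    by (simp add: lborel_distr_plus)
  also have "\<dots> = (\<integral>\<^sup>+x. f (t + x) \<partial>lborel)"
    by (subst nn_integral_distr) auto
  finally show ?thesis by simp
qed

lemma nn_integral_lborel_reflect:
  fixes f :: "'a::euclidean_space \<Rightarrow> ennreal"
  assumes [measurable]: "f \<in> borel_measurable borel"
  shows "(\<integral>\<^sup>+x. f (t - x) \<partial>lborel) = (\<integral>\<^sup>+x. f x \<partial>lborel)"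
proof -
  have "(\<integral>\<^sup>+x. f x \<partial>lborel) = (\<integral>\<^sup>+x. f x \<partial>density (distr lborel borel (\<lambda>x. t + (-1) *\<^sub>R x)) (\<lambda>_. 1))"
    using lborel_affine[of "-1" t] by simp
  also have "\<dots> = (\<integral>\<^sup>+x. f (t - x) \<partial>lborel)"
    by (subst density_1, subst nn_integral_distr) auto
  finally show ?thesis by simp
qed

text \<open>The uniqueness argument for Haar measure, tested against the indicator of the unit ball,
  which is invariant under \<open>T\<close>.\<close>

lemma nn_integral_lborel_orthogonal_transformation:
  fixes f :: "'a::euclidean_space \<Rightarrow> ennreal" and T :: "'a \<Rightarrow> 'a"
  assumes f[measurable]: "f \<in> borel_measurable borel" and T: "orthogonal_transformation T"
  shows "(\<integral>\<^sup>+x. f (T x) \<partial>lborel) = (\<integral>\<^sup>+x. f x \<partial>lborel)"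
proof -
  have lin: "linear T" and nrm: "norm (T x) = norm x" for x
    using T by (auto simp: orthogonal_transformation)
  have [measurable]: "T \<in> borel_measurable borel"
    using lin by (simp add: borel_measurable_continuous_onI linear_continuous_on linear_linear)
  define g :: "'a \<Rightarrow> ennreal" where "g = indicator (ball 0 1)"
  have g[measurable]: "g \<in> borel_measurable borel"
    unfolding g_def by (rule borel_measurable_indicator) simp
  have gT: "g (T x) = g x" for x by (simp add: g_def indicator_def nrm)
  define c where "c = (\<integral>\<^sup>+y. g y \<partial>lborel)"
  have c: "c \<noteq> 0" "c \<noteq> \<infinity>"
    using emeasure_lborel_ball_finite[of "0::'a" 1] content_ball_pos[of 1 "0::'a"]
    by (auto simp: c_def g_def measure_def)
  have "(\<integral>\<^sup>+x. f (T x) \<partial>lborel) * c = (\<integral>\<^sup>+x. f (T x) * c \<partial>lborel)"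
    by (simp add: nn_integral_multc)
  also have "\<dots> = (\<integral>\<^sup>+x. \<integral>\<^sup>+y. f (T x) * g (- T x + y) \<partial>lborel \<partial>lborel)"
  proof (rule nn_integral_cong)
    fix x
    show "f (T x) * c = (\<integral>\<^sup>+y. f (T x) * g (- T x + y) \<partial>lborel)"
      using nn_integral_lborel_translate[OF g, of "- T x"] by (simp add: nn_integral_cmult c_def)
  qed
  also have "\<dots> = (\<integral>\<^sup>+y. \<integral>\<^sup>+x. f (T x) * g (- T x + y) \<partial>lborel \<partial>lborel)"
    by (rule lborel_pair.Fubini'[symmetric]) measurable
  also have "\<dots> = (\<integral>\<^sup>+y. \<integral>\<^sup>+x. f (y - T x) * g x \<partial>lborel \<partial>lborel)"
  proof (rule nn_integral_cong)
    fix y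
    \<comment> \<open>Substituting \<open>z - x\<close> for \<open>x\<close> turns the argument of
      \<open>g\<close> into \<open>T x\<close>, and \<open>g\<close> does not see
      \<open>T\<close>.\<close>
    obtain z where z: "T z = y"
      using orthogonal_transformation_surj[OF T] by (metis surjD)
    have "(\<integral>\<^sup>+x. f (T x) * g (- T x + y) \<partial>lborel) =
        (\<integral>\<^sup>+x. f (T (z - x)) * g (- T (z - x) + y) \<partial>lborel)"
      by (rule nn_integral_lborel_reflect[symmetric]) measurable
    also have "\<dots> = (\<integral>\<^sup>+x. f (y - T x) * g x \<partial>lborel)"
      by (simp add: linear_diff[OF lin] z gT)
    finally show "(\<integral>\<^sup>+x. f (T x) * g (- T x + y) \<partial>lborel) = (\<integral>\<^sup>+x. f (y - T x) * g x \<partial>lborel)" .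
  qed
  also have "\<dots> = (\<integral>\<^sup>+x. \<integral>\<^sup>+y. f (y - T x) * g x \<partial>lborel \<partial>lborel)"
    by (rule lborel_pair.Fubini') measurable
  also have "\<dots> = (\<integral>\<^sup>+x. (\<integral>\<^sup>+y. f y \<partial>lborel) * g x \<partial>lborel)"
  proof (rule nn_integral_cong)
    fix x
    show "(\<integral>\<^sup>+y. f (y - T x) * g x \<partial>lborel) = (\<integral>\<^sup>+y. f y \<partial>lborel) * g x"
      using nn_integral_lborel_translate[OF f, of "- T x"] by (simp add: nn_integral_multc)
  qed
  also have "\<dots> = (\<integral>\<^sup>+y. f y \<partial>lborel) * c"
    by (simp add: nn_integral_cmult c_def)
  finally show ?thesis
    using c by (metis ennreal_mult_divide_eq infinity_ennreal_def)
qed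

text \<open>The sublevel set is a ball of radius \<open>sqrt (2 * x)\<close>. Half of the squared
  norm is pushed forward, rather than the norm, so that Gaussian integrals turn into Gamma
  integrals.\<close>

lemma emeasure_distr_half_norm_sq:
  assumes "x \<ge> 0"
  shows "emeasure (distr lborel borel (\<lambda>z::'a::euclidean_space. (norm z)\<^sup>2 / 2)) {..x} =
    ennreal ((2 * pi) powr (DIM('a) / 2) / Gamma (DIM('a) / 2 + 1) * x powr (DIM('a) / 2))"
proof -
  have "(norm z)\<^sup>2 / 2 \<le> x \<longleftrightarrow> norm z \<le> sqrt (2 * x)" for z :: 'a
    using real_le_rsqrt[of "norm z" "2 * x"] sqrt_le_D[of "(norm z)\<^sup>2" "2 * x"]
      assms real_sqrt_le_iff[of "(norm z)\<^sup>2" "2 * x"] by auto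
  then have "(\<lambda>z::'a. (norm z)\<^sup>2 / 2) -` {..x} = cball 0 (sqrt (2 * x))"
    by auto
  then have "emeasure (distr lborel borel (\<lambda>z::'a. (norm z)\<^sup>2 / 2)) {..x} =
      ennreal (unit_ball_vol DIM('a) * sqrt (2 * x) ^ DIM('a))"
    using assms by (simp add: emeasure_distr emeasure_cball)
  also have "sqrt (2 * x) ^ DIM('a) = 2 powr (DIM('a) / 2) * x powr (DIM('a) / 2)"
    using assms by (simp add: powr_half_sqrt_powr[symmetric] powr_mult powr_half_sqrt[symmetric]
        powr_realpow'[symmetric] powr_powr)
  finally show ?thesis
    by (simp add: unit_ball_vol_def powr_mult mult_ac)
qed

text \<open>This replaces polar coordinates: the density is the derivative of the ball volume in
  \<open>t\<close>, and the two measures on the line agree because they agree on all half-lines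
  \<open>{..x}\<close>.\<close>

lemma nn_integral_half_norm_sq:
  fixes h :: "real \<Rightarrow> ennreal"
  assumes h[measurable]: "h \<in> borel_measurable borel"
  defines "n \<equiv> real DIM('a)"
  shows "(\<integral>\<^sup>+z. h ((norm (z::'a::euclidean_space))\<^sup>2 / 2) \<partial>lborel) =
    (\<integral>\<^sup>+t. ennreal ((2 * pi) powr (n / 2) / Gamma (n / 2) * (indicator {0..} t * t powr (n / 2 - 1))) * h t \<partial>lborel)"
proof -
  define c where "c = (2 * pi) powr (n / 2) / Gamma (n / 2)"
  have n: "n > 0" by (simp add: n_def)
  have c: "c \<ge> 0" using n by (simp add: c_def Gamma_real_nonneg)
  define M1 where "M1 = distr lborel borel (\<lambda>z::'a. (norm z)\<^sup>2 / 2)"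
  define M2 where "M2 = density lborel (\<lambda>t. ennreal (c * (indicator {0..} t * t powr (n / 2 - 1))))"
  have M2: "emeasure M2 {..x} = ennreal (c * x powr (n / 2) / (n / 2))" if "x \<ge> 0" for x
  proof -
    have "((\<lambda>t. t powr (n / 2 - 1)) has_integral (x powr (n / 2 - 1 + 1) / (n / 2 - 1 + 1))) {0..x}"
      using n that by (intro has_integral_powr_from_0) auto
    then have i: "((\<lambda>t. t powr (n / 2 - 1)) has_integral (x powr (n / 2) / (n / 2))) {0..x}"
      by simp
    have "emeasure M2 {..x} = (\<integral>\<^sup>+t. ennreal c * ennreal (indicator {0..x} t * t powr (n / 2 - 1)) \<partial>lborel)"
      unfolding M2_def using c
      by (subst emeasure_density)
         (auto simp: ennreal_mult' intro!: nn_integral_cong split: split_indicator)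
    also have "\<dots> = ennreal c * ennreal (x powr (n / 2) / (n / 2))"
      by (subst nn_integral_cmult) (simp_all add: nn_integral_has_integral_lebesgue[OF _ i])
    finally show ?thesis using c n by (simp add: ennreal_mult'[symmetric])
  qed
  have eq: "emeasure M1 {..x} = emeasure M2 {..x}" for x
  proof (cases "x \<ge> 0")
    case True
    \<comment> \<open>The factor \<open>n / 2\<close> comes from integrating
      \<open>t powr (n / 2 - 1)\<close>.\<close>
    have Gamma_eq: "Gamma (n / 2 + 1) = n / 2 * Gamma (n / 2)"
      using n by (intro Gamma_plus1) (auto elim!: nonpos_Ints_cases)
    show ?thesis
      unfolding M2[OF True] unfolding M1_def emeasure_distr_half_norm_sq[OF True] c_def
        n_def[symmetric] Gamma_eq
      by (simp add: mult_ac)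
  next
    case False
    have "\<not> (norm z)\<^sup>2 / 2 \<le> x" for z :: 'a
      using False zero_le_power2[of "norm z"] by linarith
    then have "(\<lambda>z::'a. (norm z)\<^sup>2 / 2) -` {..x} = {}"
      by (simp only: vimage_def atMost_iff) simp
    moreover have "emeasure M2 {..x} =
        (\<integral>\<^sup>+t. ennreal (c * (indicator {0..} t * t powr (n / 2 - 1))) * indicator {..x} t \<partial>lborel)"
      unfolding M2_def by (subst emeasure_density) auto
    moreover have "\<dots> = (\<integral>\<^sup>+t. 0 \<partial>(lborel :: real measure))"
      by (rule nn_integral_cong) (use False in \<open>simp split: split_indicator\<close>)
    ultimately show ?thesis by (simp add: M1_def emeasure_distr)
  qed
  have "M1 = M2"
  proof (rule measure_eqI_generator_eq[where E = "range atMost" and \<Omega> = UNIV and A = "\<lambda>i. {..real i}"])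
    show "Int_stable (range (atMost :: real \<Rightarrow> _))"
      by (auto simp: Int_stable_def)
    show "sets M1 = sigma_sets UNIV (range atMost)" "sets M2 = sigma_sets UNIV (range atMost)"
      by (simp_all add: M1_def M2_def borel_eq_atMost)
    show "(\<Union>i. {..real i}) = UNIV"
      using real_arch_simple by auto
    show "emeasure M1 {..real i} \<noteq> \<infinity>" for i
      unfolding eq M2[OF of_nat_0_le_iff] by simp
  qed (auto simp: eq)
  have "(\<integral>\<^sup>+z. h ((norm (z::'a))\<^sup>2 / 2) \<partial>lborel) = (\<integral>\<^sup>+t. h t \<partial>M1)"
    unfolding M1_def by (subst nn_integral_distr) auto
  also have "\<dots> = (\<integral>\<^sup>+t. ennreal (c * (indicator {0..} t * t powr (n / 2 - 1))) * h t \<partial>lborel)"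
    unfolding \<open>M1 = M2\<close> M2_def by (subst nn_integral_density) auto
  finally show ?thesis by (simp add: c_def)
qed

text \<open>Substitute \<open>b * t\<close> in Euler's integral. The factor \<open>b powr s\<close>
  is then removed by multiplying with \<open>b powr (- s)\<close>, which avoids division in
  \<open>ennreal\<close>.\<close>

lemma nn_integral_Gamma_scaled:
  assumes s: "s > 0" and b: "b > (0::real)"
  shows "(\<integral>\<^sup>+t. ennreal (indicator {0..} t * t powr (s - 1) * exp (- (b * t))) \<partial>lborel) =
    ennreal (Gamma s * b powr (- s))"
proof -
  have "ennreal (Gamma s) = (\<integral>\<^sup>+t. ennreal (indicator {0..} t * t powr (s - 1) / exp t) \<partial>lborel)"
    by (rule Gamma_conv_nn_integral_real[OF s])
  also have "\<dots> = ennreal b * (\<integral>\<^sup>+t. ennreal (indicator {0..} (0 + b * t) * (0 + b * t) powr (s - 1) / exp (0 + b * t)) \<partial>lborel)"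
    by (subst nn_integral_real_affine[of _ b 0]) (use b in auto)
  also have "\<dots> = (\<integral>\<^sup>+t. ennreal (b powr s) * ennreal (indicator {0..} t * t powr (s - 1) * exp (- (b * t))) \<partial>lborel)"
    using b s by (subst nn_integral_cmult[symmetric])
      (auto intro!: nn_integral_cong simp: ennreal_mult'[symmetric] powr_mult powr_diff exp_minus
         field_simps zero_le_mult_iff split: split_indicator)
  also have "\<dots> = ennreal (b powr s) * (\<integral>\<^sup>+t. ennreal (indicator {0..} t * t powr (s - 1) * exp (- (b * t))) \<partial>lborel)"
    by (rule nn_integral_cmult) auto
  finally have "ennreal (b powr (- s)) * ennreal (Gamma s) = ennreal (b powr (- s)) * ennreal (b powr s) *
      (\<integral>\<^sup>+t. ennreal (indicator {0..} t * t powr (s - 1) * exp (- (b * t))) \<partial>lborel)"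
    by (simp add: mult.assoc)
  then show ?thesis
    using b s by (simp add: ennreal_mult'[symmetric] powr_add[symmetric] mult.commute Gamma_real_nonneg)
qed

text \<open>In the variable \<open>t = (norm z)\<^sup>2 / 2\<close> the factor
  \<open>norm z ^ k\<close> is \<open>(2 * t) powr (k / 2)\<close> for \<open>t > 0\<close>, which
  shifts the exponent of the Gamma integral by \<open>k / 2\<close>.\<close>

lemma nn_integral_Gaussian_moment:
  assumes b: "b > (0::real)"
  defines "n \<equiv> real DIM('a)"
  shows "(\<integral>\<^sup>+z. ennreal (norm (z::'a::euclidean_space) ^ k * exp (- (b * ((norm z)\<^sup>2 / 2)))) \<partial>lborel) =
    ennreal ((2 * pi) powr (n / 2) * 2 powr (k / 2) * (Gamma ((n + k) / 2) / Gamma (n / 2)) *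
      b powr (- ((n + k) / 2)))"
proof -
  define c where "c = (2 * pi) powr (n / 2) / Gamma (n / 2)"
  have n: "n > 0" by (simp add: n_def)
  have c: "c \<ge> 0" using n by (simp add: c_def Gamma_real_nonneg)
  define h where "h = (\<lambda>t::real. ennreal (sqrt (2 * t) ^ k * exp (- (b * t))))"
  have h[measurable]: "h \<in> borel_measurable borel" by (simp add: h_def)
  have "(\<integral>\<^sup>+z. ennreal (norm (z::'a) ^ k * exp (- (b * ((norm z)\<^sup>2 / 2)))) \<partial>lborel) =
      (\<integral>\<^sup>+z. h ((norm (z::'a))\<^sup>2 / 2) \<partial>lborel)"
    by (simp add: h_def)
  also have "\<dots> = (\<integral>\<^sup>+t. ennreal (c * (indicator {0..} t * t powr (n / 2 - 1))) * h t \<partial>lborel)"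
    unfolding c_def n_def by (rule nn_integral_half_norm_sq[OF h])
  also have "\<dots> = (\<integral>\<^sup>+t. ennreal (c * 2 powr (k / 2)) *
      ennreal (indicator {0..} t * t powr ((n + k) / 2 - 1) * exp (- (b * t))) \<partial>lborel)"
  proof (rule nn_integral_cong)
    fix t :: real
    have "c * (indicator {0..} t * t powr (n / 2 - 1)) * (sqrt (2 * t) ^ k * exp (- (b * t))) =
      c * 2 powr (k / 2) * (indicator {0..} t * t powr ((n + k) / 2 - 1) * exp (- (b * t)))"
    \<comment> \<open>At \<open>t = 0\<close> both sides vanish, because \<open>0 powr x\<close> is
      \<open>0\<close> for every exponent, including \<open>0\<close>.\<close>
    proof (cases "t > 0")
      case True
      have "sqrt (2 * t) ^ k = 2 powr (k / 2) * t powr (k / 2)"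
        using True by (simp add: powr_realpow[symmetric] powr_half_sqrt[symmetric] powr_powr powr_mult)
      moreover have "t powr (n / 2 - 1) * t powr (k / 2) = t powr ((n + k) / 2 - 1)"
        by (simp add: powr_add[symmetric] add_divide_distrib algebra_simps)
      ultimately show ?thesis using True by (simp add: mult_ac)
    qed (auto split: split_indicator)
    then show "ennreal (c * (indicator {0..} t * t powr (n / 2 - 1))) * h t = ennreal (c * 2 powr (k / 2)) *
      ennreal (indicator {0..} t * t powr ((n + k) / 2 - 1) * exp (- (b * t)))"
      unfolding h_def using c by (cases "t \<ge> 0") (simp_all add: ennreal_mult'[symmetric])
  qed
  also have "\<dots> = ennreal (c * 2 powr (k / 2)) * ennreal (Gamma ((n + k) / 2) * b powr (- ((n + k) / 2)))"
    using n b by (subst nn_integral_cmult) (simp_all add: nn_integral_Gamma_scaled)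
  also have "\<dots> = ennreal (c * 2 powr (k / 2) * (Gamma ((n + k) / 2) * b powr (- ((n + k) / 2))))"
    using c by (simp add: ennreal_mult'[symmetric])
  finally show ?thesis by (simp add: c_def mult_ac)
qed

text \<open>Change of variables from \<open>x\<close> to \<open>D\<close> applied to the rotated
  vector \<open>transpose Q *v (x - m)\<close>, with \<open>D\<close> the diagonal matrix of the
  roots of the eigenvalues. Rotation and translation preserve Lebesgue measure; \<open>D\<close>
  contributes its determinant \<open>sqrt (det H)\<close>.\<close>

lemma nn_integral_quadratic_form:
  fixes H :: "real ^ 'n ^ 'n" and h :: "real \<Rightarrow> ennreal"
  assumes H: "pos_def H" and h[measurable]: "h \<in> borel_measurable borel"
  shows "(\<integral>\<^sup>+z. h ((norm (z :: real ^ 'n))\<^sup>2) \<partial>lborel) =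
    ennreal (sqrt (det H)) * (\<integral>\<^sup>+x. h ((x - m) \<bullet> (H *v (x - m))) \<partial>lborel)"
proof -
  obtain Q l where Q: "orthogonal_matrix Q" and Hd: "H = Q ** diag_mat l ** transpose Q"
    and l: "\<And>i. l i > 0"
    using pos_def_diagonalization[OF H] by metis
  have det: "det H = (\<Prod>i\<in>UNIV. l i)"
    unfolding Hd by (rule det_orthogonal_diag[OF Q])
  define D where "D = diag_mat (\<lambda>i. sqrt (l i))"
  \<comment> \<open>The affine change of variables takes its scaling factors as a function on
    \<open>Basis\<close>, not on the index type; \<open>c\<close> reads off the diagonal entry
    belonging to a basis vector.\<close>
  define c where "c = (\<lambda>j :: real ^ 'n. j \<bullet> (D *v j))"
  have c: "c (axis i 1) = sqrt (l i)" for i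
    by (simp add: c_def D_def diag_mat_mult_vector inner_axis')
  have Basis: "(Basis :: (real ^ 'n) set) = range (\<lambda>i. axis i 1)"
    by (auto simp: Basis_vec_def)
  have inj: "inj (\<lambda>i :: 'n. axis i (1::real))"
    by (auto simp: inj_def axis_eq_axis)
  have cpos: "c j > 0" if "j \<in> Basis" for j
    using that l by (auto simp: Basis c)
  define T where "T = (\<lambda>x :: real ^ 'n. 0 + (\<Sum>j\<in>Basis. (c j * (x \<bullet> j)) *\<^sub>R j))"
  have T: "T x = D *v x" for x
  proof -
    have "T x = (\<Sum>i\<in>UNIV. (sqrt (l i) * x $ i) *\<^sub>R axis i 1)"
      by (simp add: T_def Basis sum.reindex[OF inj] o_def c inner_axis)
    then show ?thesis
      by (simp add: D_def diag_mat_mult_vector vec_eq_iff axis_def if_distrib[of "\<lambda>c. _ * c"] cong: if_cong)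
  qed
  have "sqrt (\<Prod>i\<in>A. l i) = (\<Prod>i\<in>A. sqrt (l i))" for A
    by (induction A rule: infinite_finite_induct) (simp_all add: real_sqrt_mult)
  then have prodc: "(\<Prod>j\<in>Basis. \<bar>c j\<bar>) = sqrt (det H)"
    using l by (simp add: Basis prod.reindex[OF inj] c det less_imp_le)
  have nT: "(norm (T x))\<^sup>2 = (\<Sum>i\<in>UNIV. l i * (x $ i)\<^sup>2)" for x
    using l by (simp add: T D_def diag_mat_mult_vector norm_vec_def L2_set_def sum_nonneg
        power_mult_distrib less_imp_le)
  have orth: "orthogonal_transformation ((*v) (transpose Q))"
    using Q by (simp add: orthogonal_transformation_matrix matrix_vector_mul_linear
        del: transpose_matrix_vector)
  have [measurable]: "(\<lambda>x. x \<bullet> (H *v x)) \<in> borel_measurable borel"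
    by (intro borel_measurable_continuous_onI continuous_intros matrix_vector_mult_linear_continuous_on)
  have T_meas[measurable]: "T \<in> borel_measurable borel" by (simp add: T_def)
  have "(\<integral>\<^sup>+z. h ((norm (z :: real ^ 'n))\<^sup>2) \<partial>lborel) =
      (\<integral>\<^sup>+z. h ((norm z)\<^sup>2) \<partial>density (distr lborel borel T) (\<lambda>_. (\<Prod>j\<in>Basis. \<bar>c j\<bar>)))"
    unfolding T_def by (subst lborel_affine_euclidean[of c 0]) (use cpos in \<open>auto simp: less_imp_neq[symmetric]\<close>)
  also have "\<dots> = ennreal (sqrt (det H)) * (\<integral>\<^sup>+x. h ((norm (T x))\<^sup>2) \<partial>lborel)"
    unfolding prodc by (subst nn_integral_density) (auto simp: nn_integral_distr nn_integral_cmult)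
  also have "(\<integral>\<^sup>+x. h ((norm (T x))\<^sup>2) \<partial>lborel) = (\<integral>\<^sup>+x. h ((norm (T (transpose Q *v x)))\<^sup>2) \<partial>lborel)"
    by (rule nn_integral_lborel_orthogonal_transformation[OF _ orth, symmetric]) simp
  also have "\<dots> = (\<integral>\<^sup>+x. h (x \<bullet> (H *v x)) \<partial>lborel)"
    by (simp add: nT Hd orthogonal_diag_quadratic_form)
  also have "\<dots> = (\<integral>\<^sup>+x. h ((- m + x) \<bullet> (H *v (- m + x))) \<partial>lborel)"
    by (rule nn_integral_lborel_translate[symmetric]) simp
  finally show "(\<integral>\<^sup>+z. h ((norm (z :: real ^ 'n))\<^sup>2) \<partial>lborel) =
    ennreal (sqrt (det H)) * (\<integral>\<^sup>+x. h ((x - m) \<bullet> (H *v (x - m))) \<partial>lborel)"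
    by simp
qed

text \<open>The parameter \<open>b\<close> serves both the Gaussian itself (\<open>b = 1\<close>)
  and the wider Gaussians that dominate where Taylor's bound is useless (\<open>b = \<delta>\<close>
  and \<open>b = \<delta> / 2\<close>).\<close>

lemma has_bochner_integral_Gaussian_moment:
  fixes H :: "real ^ 'n ^ 'n"
  assumes H: "pos_def H" and b: "b > 0"
  defines "n \<equiv> real CARD('n)"
  shows "has_bochner_integral lborel
    (\<lambda>x. sqrt ((x - m) \<bullet> (H *v (x - m))) ^ k * exp (- (b * ((x - m) \<bullet> (H *v (x - m)) / 2))))
    ((2 * pi) powr (n / 2) / sqrt (det H) * 2 powr (k / 2) * (Gamma ((n + k) / 2) / Gamma (n / 2)) *
      b powr (- ((n + k) / 2)))"
    (is "has_bochner_integral _ ?f ?v")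
proof -
  have n: "n > 0" by (simp add: n_def)
  have q: "0 \<le> x \<bullet> (H *v x)" for x
    using H by (cases "x = 0") (auto simp: pos_def_def less_imp_le)
  define h where "h = (\<lambda>t::real. ennreal (sqrt t ^ k * exp (- (b * (t / 2)))))"
  have h: "h \<in> borel_measurable borel" by (simp add: h_def)
  note eq = nn_integral_quadratic_form[OF H h, of m]
  have d: "det H > 0" by (rule pos_def_det[OF H])
  let ?w = "(2 * pi) powr (n / 2) * 2 powr (k / 2) * (Gamma ((n + k) / 2) / Gamma (n / 2)) *
      b powr (- ((n + k) / 2))"
  have "ennreal (1 / sqrt (det H)) * (\<integral>\<^sup>+z. h ((norm (z :: real ^ 'n))\<^sup>2) \<partial>lborel) =
      (\<integral>\<^sup>+x. h ((x - m) \<bullet> (H *v (x - m))) \<partial>lborel)"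
    unfolding eq using d by (simp add: mult.assoc[symmetric] ennreal_mult'[symmetric])
  moreover have "(\<integral>\<^sup>+z. h ((norm (z :: real ^ 'n))\<^sup>2) \<partial>lborel) = ennreal ?w"
    using nn_integral_Gaussian_moment[OF b, of k, where 'a="real ^ 'n"] by (simp add: h_def n_def)
  ultimately have "(\<integral>\<^sup>+x. h ((x - m) \<bullet> (H *v (x - m))) \<partial>lborel) = ennreal (1 / sqrt (det H)) * ennreal ?w"
    by simp
  also have "\<dots> = ennreal ?v"
    using d by (simp add: ennreal_mult'[symmetric] mult_ac)
  finally have "(\<integral>\<^sup>+x. ennreal (?f x) \<partial>lborel) = ennreal ?v"
    by (simp add: h_def)
  moreover have "?f \<in> borel_measurable lborel"
    by (auto intro!: borel_measurable_continuous_onI continuous_intros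
        continuous_on_compose2[OF matrix_vector_mult_linear_continuous_on])
  moreover have "0 \<le> ?v"
    using n d by (intro mult_nonneg_nonneg divide_nonneg_nonneg Gamma_real_nonneg) auto
  ultimately show ?thesis
    using q by (intro has_bochner_integral_nn_integral) auto
qed

text \<open>The determinant of the inverse is the reciprocal, so the normalizing constant is
  \<open>W\<close>, which is also the case \<open>k = 0\<close>, \<open>b = 1\<close> of the moment
  formula.\<close>

lemma gaussian_measure_matrix_inv:
  fixes H :: "real ^ 'n ^ 'n"
  assumes H: "pos_def H"
  defines "W \<equiv> (2 * pi) powr (CARD('n) / 2) / sqrt (det H)"
  shows "gaussian_measure m (matrix_inv H) =
    density lborel (\<lambda>x. ennreal (exp (- ((x - m) \<bullet> (H *v (x - m)) / 2)) / W))"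
proof -
  have d: "det H > 0" by (rule pos_def_det[OF H])
  then have "invertible H" by (simp add: invertible_det_nz)
  then obtain B where B: "H ** B = mat 1" "B ** H = mat 1" by (auto simp: invertible_def)
  have inv: "matrix_inv H = B" "matrix_inv B = H"
    by (rule matrix_inv_eqI, rule B)+
  have "det H * det B = 1"
    using B(1) by (metis det_I det_mul)
  then have "det B = 1 / det H"
    using d by (simp add: field_simps)
  then have "sqrt ((2 * pi) ^ CARD('n) * det B) = W"
    by (simp add: W_def real_sqrt_divide powr_half_sqrt_powr powr_realpow)
  then show ?thesis
    by (simp add: gaussian_measure_def inv)
qed


section \<open>Third-order Taylor expansion\<close>

lemma dirderiv_eqI: "(f has_derivative f') (at x) \<Longrightarrow> dirderiv h f x = f' h"
  by (metis dirderiv_def frechet_derivative_at)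

lemma dirderiv_Basis_sum:
  fixes f :: "'a::euclidean_space \<Rightarrow> real"
  assumes "f differentiable (at x)"
  shows "dirderiv h f x = (\<Sum>b\<in>Basis. (h \<bullet> b) * dirderiv b f x)"
proof -
  have lin: "linear (frechet_derivative f (at x))"
    by (rule linear_frechet_derivative[OF assms])
  have "frechet_derivative f (at x) (\<Sum>b\<in>Basis. (h \<bullet> b) *\<^sub>R b) =
      (\<Sum>b\<in>Basis. (h \<bullet> b) * frechet_derivative f (at x) b)"
    by (simp add: linear_sum[OF lin] linear_cmul[OF lin])
  then show ?thesis
    by (simp add: dirderiv_def euclidean_representation)
qed

lemma dirderiv_linear_combination:
  fixes g :: "'k \<Rightarrow> 'a::real_normed_vector \<Rightarrow> real"
  assumes "\<And>k. k \<in> A \<Longrightarrow> g k differentiable (at x)"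
  shows "dirderiv h (\<lambda>x. \<Sum>k\<in>A. c k * g k x) x = (\<Sum>k\<in>A. c k * dirderiv h (g k) x)"
proof -
  have "((\<lambda>x. \<Sum>k\<in>A. c k * g k x) has_derivative
      (\<lambda>v. \<Sum>k\<in>A. c k * frechet_derivative (g k) (at x) v)) (at x)"
    using assms by (intro has_derivative_sum has_derivative_mult_right)
      (simp add: frechet_derivative_works)
  then show ?thesis
    by (simp add: dirderiv_eqI) (simp add: dirderiv_def)
qed

lemma C_class_3_D:
  assumes "C_class 3 f"
  shows "f differentiable (at x)" "dirderiv h f differentiable (at x)"
    "dirderiv h' (dirderiv h f) differentiable (at x)"
  using assms by (simp_all add: numeral_3_eq_3)

lemma dirderiv_Basis_sum_fun:
  fixes f :: "'a::euclidean_space \<Rightarrow> real"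
  assumes "\<And>x. f differentiable (at x)"
  shows "dirderiv h f = (\<lambda>x. \<Sum>b\<in>Basis. (h \<bullet> b) * dirderiv b f x)"
  using dirderiv_Basis_sum[OF assms] by blast

lemma D2_Basis_sum:
  fixes f :: "'a::euclidean_space \<Rightarrow> real"
  assumes f: "\<And>x. f differentiable (at x)" and f': "\<And>h x. dirderiv h f differentiable (at x)"
  shows "D2 f x h1 h2 = (\<Sum>b1\<in>Basis. \<Sum>b2\<in>Basis. (h1 \<bullet> b1) * (h2 \<bullet> b2) * D2 f x b1 b2)"
proof -
  have "D2 f x h1 h2 = (\<Sum>b2\<in>Basis. (h2 \<bullet> b2) * dirderiv h1 (dirderiv b2 f) x)"
    unfolding D2_def dirderiv_Basis_sum_fun[OF f, of h2]
    by (rule dirderiv_linear_combination) (rule f')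
  also have "\<dots> = (\<Sum>b2\<in>Basis. \<Sum>b1\<in>Basis. (h1 \<bullet> b1) * (h2 \<bullet> b2) * D2 f x b1 b2)"
    by (subst dirderiv_Basis_sum[OF f']) (simp add: sum_distrib_left D2_def mult_ac)
  finally show ?thesis
    by (subst sum.swap)
qed

text \<open>The innermost direction is expanded first, as an identity of functions that can be
  differentiated again; the sums are reordered at the end. Cubic homogeneity and boundedness of
  \<open>D3\<close> follow.\<close>

lemma D3_Basis_sum:
  fixes f :: "'a::euclidean_space \<Rightarrow> real"
  assumes "C_class 3 f"
  shows "D3 f x h1 h2 h3 =
    (\<Sum>b1\<in>Basis. \<Sum>b2\<in>Basis. \<Sum>b3\<in>Basis. (h1 \<bullet> b1) * (h2 \<bullet> b2) * (h3 \<bullet> b3) * D3 f x b1 b2 b3)"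
proof -
  note d = C_class_3_D[OF assms]
  have "dirderiv h2 (dirderiv h3 f) = (\<lambda>x. \<Sum>b3\<in>Basis. (h3 \<bullet> b3) * dirderiv h2 (dirderiv b3 f) x)"
    unfolding dirderiv_Basis_sum_fun[OF d(1), of h3]
    by (rule ext, rule dirderiv_linear_combination) (rule d)
  then have "D3 f x h1 h2 h3 = (\<Sum>b3\<in>Basis. (h3 \<bullet> b3) * D2 (dirderiv b3 f) x h1 h2)"
    by (simp add: D3_def D2_def dirderiv_linear_combination d)
  also have "\<dots> = (\<Sum>b3\<in>Basis. (h3 \<bullet> b3) *
      (\<Sum>b1\<in>Basis. \<Sum>b2\<in>Basis. (h1 \<bullet> b1) * (h2 \<bullet> b2) * D3 f x b1 b2 b3))"
    by (subst D2_Basis_sum[OF d(2,3)]) (simp add: D2_def D3_def)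
  also have "\<dots> = (\<Sum>b3\<in>Basis. \<Sum>b1\<in>Basis. \<Sum>b2\<in>Basis.
      (h1 \<bullet> b1) * (h2 \<bullet> b2) * (h3 \<bullet> b3) * D3 f x b1 b2 b3)"
    by (simp add: sum_distrib_left mult_ac)
  also have "\<dots> = (\<Sum>b1\<in>Basis. \<Sum>b3\<in>Basis. \<Sum>b2\<in>Basis.
      (h1 \<bullet> b1) * (h2 \<bullet> b2) * (h3 \<bullet> b3) * D3 f x b1 b2 b3)"
    by (rule sum.swap)
  also have "\<dots> = (\<Sum>b1\<in>Basis. \<Sum>b2\<in>Basis. \<Sum>b3\<in>Basis.
      (h1 \<bullet> b1) * (h2 \<bullet> b2) * (h3 \<bullet> b3) * D3 f x b1 b2 b3)"
    by (intro sum.cong refl sum.swap)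
  finally show ?thesis .
qed

lemma D3_scaleR:
  assumes "C_class 3 f"
  shows "D3 f x (c *\<^sub>R h) (c *\<^sub>R h) (c *\<^sub>R h) = c ^ 3 * D3 f x h h h"
  by (subst (1 2) D3_Basis_sum[OF assms])
     (simp add: sum_distrib_left power3_eq_cube mult_ac)

text \<open>Coordinates are bounded by the norm, so the basis expansion is dominated termwise by a
  sum independent of the directions.\<close>

lemma D3_bounded:
  fixes f :: "'a::euclidean_space \<Rightarrow> real"
  assumes "C_class 3 f"
  shows "\<exists>B. \<forall>h1 h2 h3. norm h1 \<le> M \<longrightarrow> norm h2 \<le> M \<longrightarrow> norm h3 \<le> M \<longrightarrow> \<bar>D3 f x h1 h2 h3\<bar> \<le> B"
proof (intro exI allI impI)
  fix h1 h2 h3 :: 'a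
  assume h: "norm h1 \<le> M" "norm h2 \<le> M" "norm h3 \<le> M"
  have M: "\<bar>h1 \<bullet> b\<bar> \<le> M" "\<bar>h2 \<bullet> b\<bar> \<le> M" "\<bar>h3 \<bullet> b\<bar> \<le> M" if "b \<in> Basis" for b
    using that h Basis_le_norm order_trans by blast+
  have "0 \<le> M" using h(1) norm_ge_zero order_trans by blast
  then show "\<bar>D3 f x h1 h2 h3\<bar> \<le>
      (\<Sum>b1\<in>Basis. \<Sum>b2\<in>Basis. \<Sum>b3\<in>Basis. M * M * M * \<bar>D3 f x b1 b2 b3\<bar>)"
    unfolding D3_Basis_sum[OF assms, of x h1 h2 h3]
    by (intro order_trans[OF sum_abs] sum_mono)
       (auto simp: abs_mult intro!: mult_mono M)
qed

section \<open>Taylor's formula along segments\<close>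

lemma has_real_derivative_along_line:
  fixes f :: "'a::real_normed_vector \<Rightarrow> real"
  assumes "\<And>x. f differentiable (at x)"
  shows "((\<lambda>t. f (x + t *\<^sub>R h)) has_real_derivative dirderiv h f (x + t *\<^sub>R h)) (at t)"
proof -
  let ?D = "frechet_derivative f (at (x + t *\<^sub>R h))"
  have D: "(f has_derivative ?D) (at (x + t *\<^sub>R h))"
    using assms by (simp add: frechet_derivative_works)
  have "((\<lambda>t. x + t *\<^sub>R h) has_derivative (\<lambda>s. s *\<^sub>R h)) (at t)"
    by (auto intro!: derivative_eq_intros)
  from diff_chain_at[OF this D] have "((\<lambda>t. f (x + t *\<^sub>R h)) has_derivative (\<lambda>s. ?D (s *\<^sub>R h))) (at t)"
    by (simp add: o_def)
  then show ?thesis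
    by (simp add: has_field_derivative_def dirderiv_def linear_cmul[OF has_derivative_linear[OF D]]
        mult_commute_abs)
qed

text \<open>Maclaurin's formula with Lagrange remainder for \<open>f (x + t *\<^sub>R h)\<close> at
  \<open>t = 1\<close>; the \<open>m\<close>-th derivative in \<open>t\<close> is the
  \<open>m\<close>-fold directional derivative along \<open>h\<close>.\<close>

lemma taylor_third_order:
  assumes "C_class 3 f" and bound: "\<And>z. \<bar>D3 f z h h h\<bar> \<le> B"
  shows "\<bar>f (x + h) - f x - dirderiv h f x - D2 f x h h / 2\<bar> \<le> B / 6"
proof -
  note d = C_class_3_D[OF assms(1)]
  define diff where "diff = (\<lambda>m t. ((dirderiv h ^^ m) f) (x + t *\<^sub>R h))"
  have "\<exists>t::real. 0 < t \<and> t < 1 \<and> diff 0 1 =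
      (\<Sum>m<3. diff m 0 / fact m * 1 ^ m) + diff 3 t / fact 3 * 1 ^ 3"
  proof (rule Maclaurin; (intro allI impI)?)
    fix m :: nat and t :: real assume "m < 3 \<and> 0 \<le> t \<and> t \<le> 1"
    then consider "m = 0" | "m = 1" | "m = 2" by linarith
    then have "(dirderiv h ^^ m) f differentiable (at z)" for z
      by cases (use d in \<open>simp_all add: numeral_2_eq_2\<close>)
    then show "(diff m has_real_derivative diff (Suc m) t) (at t)"
      unfolding diff_def using has_real_derivative_along_line by fastforce
  qed auto
  then obtain t where "f (x + h) - f x - dirderiv h f x - D2 f x h h / 2 =
      D3 f (x + t *\<^sub>R h) h h h / 6"
    by (auto simp: diff_def eval_nat_numeral D2_def D3_def fact_numeral)
  then show ?thesis
    using bound[of "x + t *\<^sub>R h"] by (simp only: abs_divide)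
qed

lemma dirderiv_minimizer_eq_0:
  fixes f :: "'a::real_normed_vector \<Rightarrow> real"
  assumes "\<And>x. f differentiable (at x)" and "\<And>z. f x \<le> f z"
  shows "dirderiv h f x = 0"
  using DERIV_local_min[OF has_real_derivative_along_line[OF assms(1), of x h 0], of 1] assms(2)
  by simp

lemma dirderiv_affine_combination:
  assumes "f differentiable (at x)" "g differentiable (at x)"
  shows "dirderiv h (\<lambda>x. f x + e * g x - c) x = dirderiv h f x + e * dirderiv h g x"
proof -
  have "((\<lambda>x. f x + e * g x - c) has_derivative
      (\<lambda>v. frechet_derivative f (at x) v + e * frechet_derivative g (at x) v - 0)) (at x)"
    using assms by (intro has_derivative_diff has_derivative_add has_derivative_mult_right has_derivative_const)
      (simp_all add: frechet_derivative_works)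
  from dirderiv_eqI[OF this] show ?thesis by (simp add: dirderiv_def)
qed

lemma hessian_quadratic_form:
  fixes f :: "real ^ 'n \<Rightarrow> real"
  assumes "\<And>x. f differentiable (at x)" "\<And>h x. dirderiv h f differentiable (at x)"
  shows "h \<bullet> (hessian f x *v h) = D2 f x h h"
proof -
  have Basis: "(Basis :: (real ^ 'n) set) = range (\<lambda>i. axis i 1)"
    by (auto simp: Basis_vec_def)
  have inj: "inj (\<lambda>i :: 'n. axis i (1::real))"
    by (auto simp: inj_def axis_eq_axis)
  have "D2 f x h h = (\<Sum>i\<in>UNIV. \<Sum>j\<in>UNIV. h $ i * h $ j * D2 f x (axis i 1) (axis j 1))"
    by (subst D2_Basis_sum[OF assms])
       (simp add: Basis sum.reindex[OF inj] o_def inner_axis)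
  also have "\<dots> = h \<bullet> (hessian f x *v h)"
    by (simp add: inner_vec_def matrix_vector_mult_def hessian_def sum_distrib_left mult_ac)
  finally show ?thesis ..
qed

text \<open>Scale \<open>h\<close> to weighted norm one, where the supremum applies, and use cubic
  homogeneity. A supremum of reals bounds its set only if that set is bounded, hence the detour
  through the Euclidean ball of radius \<open>M\<close>.\<close>

lemma abs_D3_le_D3_norm:
  fixes H :: "real ^ 'n ^ 'n"
  assumes H: "pos_def H" and f: "C_class 3 f"
  shows "\<bar>D3 f x h h h\<bar> \<le> D3_norm (matrix_inv H) f x * wnorm (matrix_inv H) h ^ 3"
proof (cases "h = 0")
  case True
  then show ?thesis using D3_scaleR[OF f, of x 0 h] by (simp add: wnorm_def)
next
  case False
  let ?S = "matrix_inv H"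
  obtain M where M: "\<And>x. norm x \<le> M * wnorm ?S x" "M > 0"
    using wnorm_matrix_inv_lower_bound[OF H] by metis
  have r: "wnorm ?S h > 0"
    using M(1)[of h] M(2) False wnorm_nonneg[of ?S h] by (cases "wnorm ?S h = 0") auto
  let ?A = "{\<bar>D3 f x h1 h2 h3\<bar> | h1 h2 h3. wnorm ?S h1 \<le> 1 \<and> wnorm ?S h2 \<le> 1 \<and> wnorm ?S h3 \<le> 1}"
  obtain B where B: "\<And>h1 h2 h3. norm h1 \<le> M \<Longrightarrow> norm h2 \<le> M \<Longrightarrow> norm h3 \<le> M \<Longrightarrow> \<bar>D3 f x h1 h2 h3\<bar> \<le> B"
    using D3_bounded[OF f, of M x] by blast
  have nM: "norm k \<le> M" if "wnorm ?S k \<le> 1" for k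
    using order_trans[OF M(1)[of k], of M] mult_left_mono[OF that, of M] M(2) by simp
  have bdd: "bdd_above ?A"
    by (rule bdd_aboveI[of _ B]) (auto intro!: B nM)
  define k where "k = (1 / wnorm ?S h) *\<^sub>R h"
  have k: "wnorm ?S k \<le> 1" using r by (simp add: k_def wnorm_scaleR)
  have "\<bar>D3 f x k k k\<bar> \<le> D3_norm ?S f x"
    unfolding D3_norm_def by (rule cSup_upper[OF _ bdd]) (use k in blast)
  moreover have "h = wnorm ?S h *\<^sub>R k" using r by (simp add: k_def)
  then have "D3 f x h h h = wnorm ?S h ^ 3 * D3 f x k k k"
    using D3_scaleR[OF f, of x "wnorm ?S h" k] by simp
  ultimately show ?thesis
    using r by (simp add: abs_mult mult.commute)
qed

text \<open>Taylor's formula is applied to \<Phi> and \<open>R\<close> separately, since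
  \<open>K\<close> bounds their third derivatives one by one; this produces the factor
  \<open>1 + \<epsilon>\<close>. The first-order terms cancel only in the combination, because
  \<open>m\<close> is stationary for \<open>I\<close>.\<close>

lemma cubic_remainder_rate_fun:
  fixes \<Phi> R :: "real ^ 'n \<Rightarrow> real" and m :: "real ^ 'n" and \<epsilon> :: real
  defines "I \<equiv> rate_fun \<Phi> R \<epsilon> m"
  assumes \<epsilon>: "\<epsilon> > 0" and \<Phi>: "C_class 3 \<Phi>" and R: "C_class 3 R"
    and min: "\<And>z. I m \<le> I z"
    and H: "pos_def (hessian I m)"
    and D3: "\<And>x. max (D3_norm (laplace_cov I m) \<Phi> x) (D3_norm (laplace_cov I m) R x) \<le> K"
  shows "\<bar>I (m + h) - h \<bullet> (hessian I m *v h) / 2\<bar> \<le> (1 + \<epsilon>) * K * wnorm (laplace_cov I m) h ^ 3 / 6"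
    and "continuous_on UNIV I"
proof -
  note d\<Phi> = C_class_3_D[OF \<Phi>] and dR = C_class_3_D[OF R]
  have I_eq: "I = (\<lambda>x. \<Phi> x + \<epsilon> * R x - (\<Phi> m + \<epsilon> * R m))"
    by (simp add: I_def rate_fun_def fun_eq_iff)
  have dI: "I differentiable (at x)" for x
    unfolding I_eq by (intro derivative_intros d\<Phi> dR)
  then show "continuous_on UNIV I"
    by (simp add: continuous_on_eq_continuous_at differentiable_imp_continuous_within)
  have d1: "dirderiv k I = (\<lambda>x. dirderiv k \<Phi> x + \<epsilon> * dirderiv k R x)" for k
    unfolding I_eq by (rule ext, rule dirderiv_affine_combination) (rule d\<Phi> dR)+
  have d1I: "dirderiv k I differentiable (at x)" for k x
    unfolding d1 by (intro derivative_intros d\<Phi> dR)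
  have d2: "D2 I m h h = D2 \<Phi> m h h + \<epsilon> * D2 R m h h"
    using dirderiv_affine_combination[of "dirderiv h \<Phi>" m "dirderiv h R" h \<epsilon> 0] d\<Phi>(2) dR(2)
    by (simp add: D2_def d1)
  have d0: "dirderiv h \<Phi> m + \<epsilon> * dirderiv h R m = 0"
    using dirderiv_minimizer_eq_0[OF dI min, of h] by (simp add: d1)
  let ?r = "\<lambda>f. f (m + h) - f m - dirderiv h f m - D2 f m h h / 2"
  let ?w = "wnorm (laplace_cov I m) h"
  have r: "\<bar>?r f\<bar> \<le> K * ?w ^ 3 / 6" if "C_class 3 f" "\<And>x. D3_norm (laplace_cov I m) f x \<le> K" for f
  proof (rule taylor_third_order[OF that(1)])
    fix z
    have "\<bar>D3 f z h h h\<bar> \<le> D3_norm (laplace_cov I m) f z * ?w ^ 3"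
      unfolding laplace_cov_def by (rule abs_D3_le_D3_norm[OF H that(1)])
    also have "\<dots> \<le> K * ?w ^ 3"
      by (intro mult_right_mono that(2)) (simp add: wnorm_nonneg)
    finally show "\<bar>D3 f z h h h\<bar> \<le> K * ?w ^ 3" .
  qed
  have DK: "D3_norm (laplace_cov I m) \<Phi> x \<le> K" "D3_norm (laplace_cov I m) R x \<le> K" for x
    using D3[of x] by simp_all
  have r\<Phi>: "\<bar>?r \<Phi>\<bar> \<le> K * ?w ^ 3 / 6" and rR: "\<bar>?r R\<bar> \<le> K * ?w ^ 3 / 6"
    by (rule r[OF \<Phi> DK(1)], rule r[OF R DK(2)])
  have "I (m + h) - h \<bullet> (hessian I m *v h) / 2 = ?r \<Phi> + \<epsilon> * ?r R"
    unfolding hessian_quadratic_form[OF dI d1I] d2 using d0 by (simp add: I_eq algebra_simps add_divide_distrib)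
  also have "\<bar>\<dots>\<bar> \<le> \<bar>?r \<Phi>\<bar> + \<epsilon> * \<bar>?r R\<bar>"
    using abs_triangle_ineq[of "?r \<Phi>" "\<epsilon> * ?r R"] \<epsilon> by (simp add: abs_mult)
  also have "\<dots> \<le> K * ?w ^ 3 / 6 + \<epsilon> * (K * ?w ^ 3 / 6)"
    using r\<Phi> rR \<epsilon> by (intro add_mono mult_left_mono) auto
  finally show "\<bar>I (m + h) - h \<bullet> (hessian I m *v h) / 2\<bar> \<le> (1 + \<epsilon>) * K * ?w ^ 3 / 6"
    by (simp add: algebra_simps add_divide_distrib)
qed


section \<open>Comparison of the two densities\<close>

lemma measure_density_eq_integral:
  assumes [measurable]: "A \<in> sets M" and p: "integrable M p" "\<And>x. 0 \<le> p x"
  shows "measure (density M (\<lambda>x. ennreal (p x))) A = (\<integral>x. indicator A x * p x \<partial>M)"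
proof -
  have [measurable]: "p \<in> borel_measurable M" using p(1) by simp
  have "emeasure (density M (\<lambda>x. ennreal (p x))) A = (\<integral>\<^sup>+x. ennreal (indicator A x * p x) \<partial>M)"
    by (subst emeasure_density) (auto intro!: nn_integral_cong split: split_indicator)
  also have "\<dots> = ennreal (\<integral>x. indicator A x * p x \<partial>M)"
    using p by (intro nn_integral_eq_integral integrable_real_mult_indicator
      integrable_mult_indicator[where 'b=real, simplified]) (auto simp: mult.commute)
  finally show ?thesis
    using p(2) by (simp add: measure_def integral_nonneg_AE)
qed

lemma tv_dist_density_le:
  fixes u g :: "'a::euclidean_space \<Rightarrow> real"
  assumes u: "integrable lborel u" "\<And>x. 0 \<le> u x" and g: "integrable lborel g" "\<And>x. 0 \<le> g x"
  defines "Z \<equiv> (\<integral>x. u x \<partial>lborel)" and "W \<equiv> (\<integral>x. g x \<partial>lborel)"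
  assumes pos: "Z > 0" "W > 0"
  shows "tv_dist (density lborel (\<lambda>x. ennreal (1 / Z * u x))) (density lborel (\<lambda>x. ennreal (g x / W)))
    \<le> (\<integral>x. \<bar>u x - g x\<bar> \<partial>lborel) / W"
  unfolding tv_dist_def
proof (rule cSUP_least)
  fix A :: "'a set" assume A: "A \<in> sets borel"
  let ?E = "\<integral>x. \<bar>u x - g x\<bar> \<partial>lborel"
  define r where "r = (\<lambda>x. 1 / Z * u x - g x / W)"
  have p: "integrable lborel (\<lambda>x. 1 / Z * u x)" "integrable lborel (\<lambda>x. g x / W)"
    using u(1) g(1) by auto
  have r: "integrable lborel r" unfolding r_def using p by (rule Bochner_Integration.integrable_diff)
  have ind: "integrable lborel (\<lambda>x. indicator A x * f x)" if "integrable lborel f" for f :: "'a \<Rightarrow> real"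
    using integrable_mult_indicator[of A lborel f] that A by simp
  have r0: "(\<integral>x. r x \<partial>lborel) = 0"
    unfolding r_def using p pos
    by (subst Bochner_Integration.integral_diff) (auto simp: Z_def[symmetric] W_def[symmetric])
  have m: "measure (density lborel (\<lambda>x. ennreal (1 / Z * u x))) A = (\<integral>x. indicator A x * (1 / Z * u x) \<partial>lborel)"
    "measure (density lborel (\<lambda>x. ennreal (g x / W))) A = (\<integral>x. indicator A x * (g x / W) \<partial>lborel)"
    by (rule measure_density_eq_integral; use A p u(2) g(2) pos in auto)+
  have "measure (density lborel (\<lambda>x. ennreal (1 / Z * u x))) A -
      measure (density lborel (\<lambda>x. ennreal (g x / W))) A = (\<integral>x. indicator A x * r x \<partial>lborel)"
    unfolding m r_def right_diff_distrib
    by (rule Bochner_Integration.integral_diff[OF ind[OF p(1)] ind[OF p(2)], symmetric])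
  \<comment> \<open>As \<open>r\<close> integrates to zero, \<open>1 / 2\<close> may be subtracted
    from the indicator; the new weight has absolute value \<open>1 / 2\<close> everywhere.\<close>
  also have "\<dots> = (\<integral>x. (indicator A x - 1 / 2) * r x \<partial>lborel)"
    using r r0 by (simp add: left_diff_distrib Bochner_Integration.integral_diff ind)
  also have "\<bar>\<dots>\<bar> \<le> (\<integral>x. \<bar>(indicator A x - 1 / 2) * r x\<bar> \<partial>lborel)"
    by (rule integral_abs_bound)
  also have "\<dots> = (\<integral>x. 1 / 2 * \<bar>r x\<bar> \<partial>lborel)"
    by (intro Bochner_Integration.integral_cong) (auto simp: abs_mult split: split_indicator)
  also have "\<dots> \<le> (\<integral>x. 1 / 2 * (\<bar>1 / Z - 1 / W\<bar> * u x + \<bar>u x - g x\<bar> / W) \<partial>lborel)"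
  proof (rule integral_mono)
    fix x
    \<comment> \<open>The first summand measures the mismatch of the normalizations. Its
      \<open>L\<^sup>1\<close> norm is \<open>\<bar>Z - W\<bar> / W\<close>, which is at most
      \<open>?E / W\<close>, the norm of the second.\<close>
    have "r x = (1 / Z - 1 / W) * u x + (u x - g x) / W"
      by (simp add: r_def algebra_simps diff_divide_distrib)
    also have "\<bar>\<dots>\<bar> \<le> \<bar>(1 / Z - 1 / W) * u x\<bar> + \<bar>(u x - g x) / W\<bar>"
      by (rule abs_triangle_ineq)
    finally show "1 / 2 * \<bar>r x\<bar> \<le> 1 / 2 * (\<bar>1 / Z - 1 / W\<bar> * u x + \<bar>u x - g x\<bar> / W)"
      using u(2)[of x] pos by (simp add: abs_mult)
  qed (use r u(1) g(1) in auto)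
  also have "\<dots> = 1 / 2 * (\<bar>1 / Z - 1 / W\<bar> * Z + ?E / W)"
    using u(1) g(1) by (simp add: Bochner_Integration.integral_add Z_def)
  also have "\<bar>1 / Z - 1 / W\<bar> * Z = \<bar>Z - W\<bar> / W"
  proof -
    have "1 / Z - 1 / W = - (Z - W) / (Z * W)" using pos by (simp add: field_simps)
    then show ?thesis using pos by (simp only: abs_divide abs_minus abs_mult) simp
  qed
  also have "\<bar>Z - W\<bar> \<le> ?E"
    using integral_abs_bound[of lborel "\<lambda>x. u x - g x"] u(1) g(1)
    by (simp add: Z_def W_def Bochner_Integration.integral_diff)
  finally show "\<bar>measure (density lborel (\<lambda>x. ennreal (1 / Z * u x))) A -
      measure (density lborel (\<lambda>x. ennreal (g x / W))) A\<bar> \<le> ?E / W"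
    using pos by (simp add: divide_right_mono field_simps)
qed auto

text \<open>Both cases come from \<open>1 + s \<le> exp s\<close>: with \<open>s = - t\<close>,
  multiplied by \<open>exp t\<close>, for \<open>t \<ge> 0\<close>, and with \<open>s = t\<close>
  otherwise.\<close>

lemma abs_exp_diff_1_le: "\<bar>exp t - 1\<bar> \<le> \<bar>t\<bar> * exp \<bar>t\<bar>" for t :: real
proof (cases "t \<ge> 0")
  case True
  have "(1 - t) * exp t \<le> exp (- t) * exp t"
    using exp_ge_add_one_self[of "- t"] by (intro mult_right_mono) auto
  then show ?thesis using True by (simp add: exp_minus algebra_simps)
next
  case False
  have "1 - exp t \<le> - t * 1" using exp_ge_add_one_self[of t] by linarith
  also have "\<dots> \<le> - t * exp (- t)" using False by (intro mult_left_mono) auto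
  finally show ?thesis using False by simp
qed

text \<open>Each of the two regions needs only one summand of the bound and the other is
  nonnegative, so the sum holds for every \<open>w\<close> and can be integrated over the whole
  space. In the application \<open>i\<close> is \<open>I x / \<epsilon>\<close>.\<close>

lemma exp_perturbation_bound:
  fixes w :: real
  assumes "0 \<le> w" "0 \<le> \<kappa>" "\<delta> \<le> 1"
    and near: "\<bar>i - w\<^sup>2 / 2\<bar> \<le> \<kappa> * w ^ 3 / 6"
    and lower: "\<delta> * w\<^sup>2 / 2 \<le> i"
    and far: "1 < \<kappa> * w ^ 3 / 6 \<Longrightarrow> S \<le> \<delta> * w\<^sup>2"
  shows "\<bar>exp (- i) - exp (- (w\<^sup>2 / 2))\<bar> \<le>
    exp 1 * \<kappa> / 6 * (w ^ 3 * exp (- (w\<^sup>2 / 2))) + exp (- S / 4) * exp (- (\<delta> / 2 * (w\<^sup>2 / 2)))"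
proof (cases "\<kappa> * w ^ 3 / 6 \<le> 1")
  case True
  define t where "t = w\<^sup>2 / 2 - i"
  have t: "\<bar>t\<bar> \<le> \<kappa> * w ^ 3 / 6" using near by (simp add: t_def abs_minus_commute)
  have "exp (- i) - exp (- (w\<^sup>2 / 2)) = exp (- (w\<^sup>2 / 2)) * (exp t - 1)"
    by (simp add: t_def algebra_simps exp_add[symmetric])
  then have "\<bar>exp (- i) - exp (- (w\<^sup>2 / 2))\<bar> = exp (- (w\<^sup>2 / 2)) * \<bar>exp t - 1\<bar>"
    by (simp add: abs_mult)
  also have "\<dots> \<le> exp (- (w\<^sup>2 / 2)) * (\<kappa> * w ^ 3 / 6 * exp 1)"
  proof (intro mult_left_mono order_trans[OF abs_exp_diff_1_le] mult_mono t)
    show "exp \<bar>t\<bar> \<le> exp 1" using t True by (simp only: exp_le_cancel_iff)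
  qed (use assms(1,2) in auto)
  also have "\<dots> = exp 1 * \<kappa> / 6 * (w ^ 3 * exp (- (w\<^sup>2 / 2)))" by simp
  also have "\<dots> \<le> \<dots> + exp (- S / 4) * exp (- (\<delta> / 2 * (w\<^sup>2 / 2)))" by simp
  finally show ?thesis .
next
  case False
  \<comment> \<open>Because of \<open>\<delta> \<le> 1\<close>, one wide Gaussian dominates both
    exponentials.\<close>
  have "\<delta> * w\<^sup>2 \<le> 1 * w\<^sup>2" using assms(3) by (intro mult_right_mono) auto
  then have "exp (- (w\<^sup>2 / 2)) \<le> exp (- (\<delta> * w\<^sup>2 / 2))" by simp
  moreover have "exp (- i) \<le> exp (- (\<delta> * w\<^sup>2 / 2))" using lower by simp
  moreover have "exp (- i) > 0" "exp (- (w\<^sup>2 / 2)) > 0" by simp_all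
  ultimately have "\<bar>exp (- i) - exp (- (w\<^sup>2 / 2))\<bar> \<le> exp (- (\<delta> * w\<^sup>2 / 2))"
    by linarith
  \<comment> \<open>Half of the exponent, \<open>\<delta> * w\<^sup>2 / 4\<close>, is at least
    \<open>S / 4\<close> by \<open>far\<close>; the other half stays to be integrated.\<close>
  also have "\<dots> \<le> exp (- S / 4 + - (\<delta> / 2 * (w\<^sup>2 / 2)))" using far False by simp
  also have "\<dots> = exp (- S / 4) * exp (- (\<delta> / 2 * (w\<^sup>2 / 2)))" by (rule exp_add)
  also have "\<dots> \<le> exp 1 * \<kappa> / 6 * (w ^ 3 * exp (- (w\<^sup>2 / 2))) + \<dots>" using assms(1,2) by simp
  finally show ?thesis .
qed

text \<open>Here \<open>S = (6 \<delta>\<^sup>3\<^sup>/\<^sup>2 / \<kappa>)\<^sup>2\<^sup>/\<^sup>3\<close>, so that the two entries of the maximum read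
  \<open>S \<ge> 4 d\<close> and \<open>S \<ge> 8 L\<close>; splitting \<open>S / 4 = S / 8 + S / 8\<close>, the first half absorbs \<open>2\<^sup>d\<^sup>/\<^sup>2\<close>.\<close>

lemma tail_bound:
  fixes d a :: real
  assumes d: "d > 0" and \<delta>: "\<delta> > 0" and \<kappa>: "\<kappa> > 0" and a: "a > 0"
  defines "X \<equiv> 6 * \<delta> powr (3/2) / \<kappa>"
  defines "L \<equiv> ln (2 / (a * \<delta> powr (d/2)))"
  assumes X: "X \<ge> max (8 * d powr (3/2)) (if L < 0 then 0 else (8 * L) powr (3/2))"
  shows "exp (- (X powr (2/3)) / 4) * (\<delta> / 2) powr (- (d/2)) \<le> a"
proof -
  define S where "S = X powr (2/3)"
  have X0: "X > 0" using \<delta> \<kappa> by (simp add: X_def)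
  have "(8 * d powr (3/2)) powr (2/3) \<le> S"
    unfolding S_def using X d by (intro powr_mono2) auto
  moreover have "(8 * d powr (3/2)) powr (2/3) = 4 * d"
  proof -
    have "(8::real) powr (2/3) = (2 powr 3) powr (2/3)" by simp
    also have "\<dots> = 4" by (simp only: powr_powr) simp
    finally show ?thesis using d by (simp add: powr_mult powr_powr)
  qed
  ultimately have S4: "4 * d \<le> S" by simp
  have S8: "8 * L \<le> S"
  \<comment> \<open>For negative \<open>L\<close> the maximum carries no information on
    \<open>L\<close>, but \<open>S\<close> is nonnegative.\<close>
  proof (cases "L < 0")
    case True
    have "0 \<le> S" by (simp add: S_def)
    with True show ?thesis by linarith
  next
    case False
    then have "((8 * L) powr (3/2)) powr (2/3) \<le> S"
      unfolding S_def using X by (intro powr_mono2) auto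
    then show ?thesis using False by (simp add: powr_powr)
  qed
  have "2 powr (d/2) = exp (d / 2 * ln 2)" by (simp add: powr_def)
  also have "\<dots> \<le> exp (S / 8)"
  proof -
    have "d / 2 * ln 2 \<le> d / 2 * 1" using d ln_2_less_1 by (intro mult_left_mono) auto
    then show ?thesis using S4 by simp
  qed
  finally have two: "2 powr (d/2) \<le> exp (S / 8)" .
  have "exp (- S / 4) * (\<delta> / 2) powr (- (d/2)) = exp (- S / 8) * (exp (- S / 8) * 2 powr (d/2)) / \<delta> powr (d/2)"
  proof -
    have "(\<delta> / 2) powr (- (d/2)) = 2 powr (d/2) / \<delta> powr (d/2)"
      using \<delta> by (simp add: powr_minus powr_divide)
    moreover have "exp (- S / 4) = exp (- S / 8) * exp (- S / 8)"
      by (simp add: exp_add[symmetric])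
    ultimately show ?thesis by simp
  qed
  also have "\<dots> \<le> exp (- L) * 1 / \<delta> powr (d/2)"
  proof (intro divide_right_mono mult_mono)
    show "exp (- S / 8) \<le> exp (- L)" using S8 by simp
    have "exp (- S / 8) * 2 powr (d/2) \<le> exp (- S / 8) * exp (S / 8)"
      using two by (intro mult_left_mono) auto
    then show "exp (- S / 8) * 2 powr (d/2) \<le> 1" by (simp add: exp_add[symmetric])
  qed auto
  \<comment> \<open>\<open>exp (- L)\<close> is \<open>a * \<delta> powr (d/2) / 2\<close>, so the
    powers of \<delta> cancel.\<close>
  also have "\<dots> = a / 2"
    using a \<delta> by (simp add: L_def exp_minus)
  finally show ?thesis using a by (simp add: S_def)
qed

text \<open>Multiply \<open>6 / \<kappa> \<le> w ^ 3\<close> by \<open>\<delta> powr (3/2)\<close>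
  and take the power \<open>2/3\<close>: the boundary of the region becomes a lower bound on the
  exponent.\<close>

lemma far_region:
  fixes \<delta> \<kappa> w :: real
  assumes "\<delta> > 0" "\<kappa> > 0" "w \<ge> 0" "1 < \<kappa> * w ^ 3 / 6"
  shows "(6 * \<delta> powr (3/2) / \<kappa>) powr (2/3) \<le> \<delta> * w\<^sup>2"
proof -
  have w: "w > 0" using assms by (cases "w = 0") auto
  have "6 / \<kappa> \<le> w ^ 3" using assms by (simp add: field_simps)
  then have "\<delta> powr (3/2) * (6 / \<kappa>) \<le> \<delta> powr (3/2) * w ^ 3"
    by (intro mult_left_mono) auto
  then have "(6 * \<delta> powr (3/2) / \<kappa>) powr (2/3) \<le> (\<delta> powr (3/2) * w ^ 3) powr (2/3)"
    using assms by (intro powr_mono2) (auto simp: mult_ac)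
  also have "w ^ 3 = w powr 3" using w by simp
  also have "(\<delta> powr (3/2) * w powr 3) powr (2/3) = \<delta> * w\<^sup>2"
    using assms(1) w by (simp add: powr_mult powr_powr del: powr_numeral) simp
  finally show ?thesis .
qed

text \<open>A zero integral would make \<open>u\<close> vanish almost everywhere, although Lebesgue
  measure is not zero. This gives the positivity of the normalization constant.\<close>

lemma integrable_lborel_pos_integral:
  fixes u :: "'a::euclidean_space \<Rightarrow> real"
  assumes "integrable lborel u" "\<And>x. 0 < u x"
  shows "(\<integral>x. u x \<partial>lborel) > 0"
proof -
  have "(\<integral>x. u x \<partial>lborel) \<noteq> 0"
  proof
    assume "(\<integral>x. u x \<partial>lborel) = 0"
    then have "AE x in lborel. u x = 0"
      using assms by (subst (asm) integral_nonneg_eq_0_iff_AE) (auto simp: less_imp_le)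
    then have "AE x in (lborel :: 'a measure). False"
      by eventually_elim (use assms(2) in \<open>metis less_irrefl\<close>)
    then show False
      by (simp add: ae_filter_eq_bot_iff trivial_limit_def[symmetric])
  qed
  moreover have "(\<integral>x. u x \<partial>lborel) \<ge> 0"
    using assms(2) by (simp add: integral_nonneg_AE less_imp_le)
  ultimately show ?thesis by linarith
qed

theorem theorem4p1:
  fixes G :: "real ^ 'n \<Rightarrow> real ^ 'n" and R :: "real ^ 'n \<Rightarrow> real"
    and y xhat :: "real ^ 'n" and \<epsilon> K \<delta> :: real
  defines "d \<equiv> real CARD('n)"
    and "\<Phi> \<equiv> misfit G y"
    and "C \<equiv> sqrt 2 * exp 1 / 3"
  defines "I \<equiv> rate_fun \<Phi> R \<epsilon> xhat"
  defines "\<Sigma> \<equiv> laplace_cov I xhat"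
  defines "L \<equiv> ln (2 / (C * (1 + \<epsilon>) * \<epsilon> powr (1/2) * K * \<delta> powr (d/2))
                   * (Gamma (d/2) / Gamma (d/2 + 3/2)))"
  assumes "\<epsilon> > 0"
    and "prob_space (prior R)"
    and "is_map_estimate \<Phi> R \<epsilon> xhat"
    and "C_class 3 \<Phi>" and "C_class 3 R"
    and "unique_minimizer I xhat"
    and "pos_def (hessian I xhat)"
    and "K > 0"
    and "\<forall>x. max (D3_norm \<Sigma> \<Phi> x) (D3_norm \<Sigma> R x) \<le> K"
    and "0 < \<delta>" and "\<delta> \<le> 1"
    and "\<forall>x. I x \<ge> \<delta> / 2 * (wnorm \<Sigma> (x - xhat))\<^sup>2"
    and "6 * \<delta> powr (3/2) / ((1 + \<epsilon>) * \<epsilon> powr (1/2) * K)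
           \<ge> max (8 * d powr (3/2)) (if L < 0 then 0 else (8 * L) powr (3/2))"
  shows "tv_dist (posterior I \<epsilon>) (laplace_approx I \<epsilon> xhat)
           \<le> 2 * C * (1 + \<epsilon>) * \<epsilon> powr (1/2) * K * (Gamma (d/2 + 3/2) / Gamma (d/2))"
proof -
  note \<epsilon> = assms(7) and \<Phi>C = assms(10) and RC = assms(11) and H = assms(13) and K = assms(14)
    and D3K = assms(15) and \<delta> = assms(16,17) and lower = assms(18) and max_le = assms(19)
  have dn: "d = real CARD('n)" and d: "d > 0" by (simp_all add: d_def)
  define H where "H = hessian I xhat"
  \<comment> \<open>\<open>H'\<close> is the inverse of the covariance
    \<open>\<epsilon> \<Sigma>\<close>, \<open>Q\<close> the squared distance to \<open>xhat\<close>
    in its weighted norm, and \<open>W\<close> the total mass of \<open>g\<close>.\<close>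
  define H' where "H' = (1 / \<epsilon>) *\<^sub>R H"
  define Q where "Q = (\<lambda>x. (x - xhat) \<bullet> (H' *v (x - xhat)))"
  define W where "W = (2 * pi) powr (d / 2) / sqrt (det H')"
  define \<kappa> where "\<kappa> = (1 + \<epsilon>) * \<epsilon> powr (1/2) * K"
  define \<Gamma>r where "\<Gamma>r = Gamma (d/2 + 3/2) / Gamma (d/2)"
  \<comment> \<open>\<open>a\<close> is half of the claimed bound.\<close>
  define a where "a = C * \<kappa> * \<Gamma>r"
  define S where "S = (6 * \<delta> powr (3/2) / \<kappa>) powr (2/3)"
  define u where "u = (\<lambda>x. exp (- (1 / \<epsilon>) * I x))"
  define g where "g = (\<lambda>x. exp (- (Q x / 2)))"
  have posH: "pos_def H" using H by (simp add: H_def)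
  then have posH': "pos_def H'" using \<epsilon> by (simp add: H'_def pos_def_scaleR)
  have detH': "det H' > 0" by (rule pos_def_det[OF posH'])
  have W: "W > 0" using detH' by (simp add: W_def)
  have \<kappa>: "\<kappa> > 0" using \<epsilon> K by (simp add: \<kappa>_def)
  have \<Gamma>r: "\<Gamma>r > 0" using d by (simp add: \<Gamma>r_def)
  have a: "a > 0" using \<kappa> \<Gamma>r by (simp add: a_def C_def)
  have \<Sigma>: "\<Sigma> = matrix_inv H" by (simp add: \<Sigma>_def laplace_cov_def H_def)
  have qH: "(x - xhat) \<bullet> (H *v (x - xhat)) = (wnorm \<Sigma> (x - xhat))\<^sup>2" for x
    unfolding \<Sigma> by (rule wnorm_matrix_inv_sq[OF posH, symmetric])
  have Q: "Q x = (wnorm \<Sigma> (x - xhat))\<^sup>2 / \<epsilon>" for x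
    by (simp add: Q_def H'_def scaleR_matrix_vector_assoc[symmetric] qH)
  have sqrtQ: "sqrt (Q x) = wnorm \<Sigma> (x - xhat) / sqrt \<epsilon>" and Q0: "Q x \<ge> 0" for x
    using \<epsilon> by (simp_all add: Q real_sqrt_divide wnorm_nonneg)

  have min: "I xhat \<le> I z" for z
    using assms(12) by (cases "z = xhat") (auto simp: unique_minimizer_def less_imp_le)
  note rem = cubic_remainder_rate_fun[OF \<epsilon> \<Phi>C RC min[unfolded I_def] H[unfolded I_def],
      of K, folded I_def \<Sigma>_def H_def]
  have near: "\<bar>I x / \<epsilon> - Q x / 2\<bar> \<le> \<kappa> * sqrt (Q x) ^ 3 / 6" for x
  proof -
    have "\<bar>I x - (x - xhat) \<bullet> (H *v (x - xhat)) / 2\<bar> \<le> (1 + \<epsilon>) * K * wnorm \<Sigma> (x - xhat) ^ 3 / 6"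
      using rem(1)[of "x - xhat"] D3K by simp
    then have "\<bar>I x - (x - xhat) \<bullet> (H *v (x - xhat)) / 2\<bar> / \<epsilon> \<le>
        (1 + \<epsilon>) * K * wnorm \<Sigma> (x - xhat) ^ 3 / 6 / \<epsilon>"
      using \<epsilon> by (intro divide_right_mono) auto
    also have "\<bar>I x - (x - xhat) \<bullet> (H *v (x - xhat)) / 2\<bar> / \<epsilon> = \<bar>I x / \<epsilon> - Q x / 2\<bar>"
    proof -
      have "I x / \<epsilon> - Q x / 2 = (I x - (x - xhat) \<bullet> (H *v (x - xhat)) / 2) / \<epsilon>"
        by (simp add: qH Q diff_divide_distrib mult.commute)
      then show ?thesis using \<epsilon> by (simp add: abs_divide)
    qed
    \<comment> \<open>Passing from \<Sigma> to \<open>\<epsilon> \<Sigma>\<close> scales the cube of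
      the norm by \<open>\<epsilon> powr (3/2)\<close>; dividing by \<epsilon> leaves the factor
      \<open>\<epsilon> powr (1/2)\<close> of \<kappa>.\<close>
    also have "(1 + \<epsilon>) * K * wnorm \<Sigma> (x - xhat) ^ 3 / 6 / \<epsilon> = \<kappa> * sqrt (Q x) ^ 3 / 6"
    proof -
      have s3: "sqrt \<epsilon> ^ 3 = \<epsilon> * sqrt \<epsilon>" using \<epsilon> by (simp add: power3_eq_cube)
      have "\<kappa> * sqrt (Q x) ^ 3 / 6 = (1 + \<epsilon>) * sqrt \<epsilon> * K * (wnorm \<Sigma> (x - xhat) ^ 3 / (\<epsilon> * sqrt \<epsilon>)) / 6"
        using \<epsilon> by (simp only: \<kappa>_def sqrtQ power_divide s3 powr_half_sqrt less_imp_le)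
      then show ?thesis using \<epsilon> by simp
    qed
    finally show ?thesis .
  qed
  have low: "\<delta> * Q x / 2 \<le> I x / \<epsilon>" for x
    using lower \<epsilon> by (simp add: Q divide_right_mono field_simps)
  \<comment> \<open>The factors \<open>1 *\<close> and \<open>sqrt (Q x) ^ 0\<close> are kept so
    that both summands are literal instances of the moment formula.\<close>
  have bound: "\<bar>u x - g x\<bar> \<le> exp 1 * \<kappa> / 6 * (sqrt (Q x) ^ 3 * exp (- (1 * (Q x / 2)))) +
      exp (- S / 4) * (sqrt (Q x) ^ 0 * exp (- (\<delta> / 2 * (Q x / 2))))" for x
    using exp_perturbation_bound[of "sqrt (Q x)" \<kappa> \<delta> "I x / \<epsilon>" S] Q0[of x] \<kappa> \<delta> near[of x] low[of x]
      far_region[of \<delta> \<kappa> "sqrt (Q x)"]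
    by (simp add: u_def g_def S_def)

  have \<Gamma>0: "Gamma (d / 2) \<noteq> 0"
    using d by (intro less_imp_neq[symmetric] Gamma_real_pos) simp
  have moment: "has_bochner_integral lborel (\<lambda>x. sqrt (Q x) ^ k * exp (- (b * (Q x / 2))))
      (W * 2 powr (k / 2) * (Gamma ((d + k) / 2) / Gamma (d / 2)) * b powr (- ((d + k) / 2)))"
    if "b > 0" for b :: real and k :: nat
    unfolding Q_def W_def dn by (rule has_bochner_integral_Gaussian_moment[OF posH' that])
  \<comment> \<open>This moment determines \<open>C\<close>: the prefactor \<open>exp 1 / 6\<close>
    times \<open>2 * sqrt 2\<close> is \<open>sqrt 2 * exp 1 / 3\<close>, so the near contribution
    is exactly \<open>W * a\<close>.\<close>
  have i3: "has_bochner_integral lborel (\<lambda>x. sqrt (Q x) ^ 3 * exp (- (1 * (Q x / 2))))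
      (W * (2 * sqrt 2) * \<Gamma>r)"
  proof -
    have "(2::real) powr (3/2) = 2 powr (1 + 1/2)" by simp
    also have "\<dots> = 2 * sqrt 2" by (simp only: powr_add powr_half_sqrt) simp
    finally show ?thesis
      using moment[of 1 3] by (simp add: \<Gamma>r_def add_divide_distrib)
  qed
  have i0: "has_bochner_integral lborel (\<lambda>x. sqrt (Q x) ^ 0 * exp (- (b * (Q x / 2)))) (W * b powr (- (d/2)))"
    if "b > 0" for b
    using moment[OF that, of 0] \<Gamma>0 by simp
  have B: "has_bochner_integral lborel (\<lambda>x. exp 1 * \<kappa> / 6 * (sqrt (Q x) ^ 3 * exp (- (1 * (Q x / 2)))) +
      exp (- S / 4) * (sqrt (Q x) ^ 0 * exp (- (\<delta> / 2 * (Q x / 2)))))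
      (exp 1 * \<kappa> / 6 * (W * (2 * sqrt 2) * \<Gamma>r) + exp (- S / 4) * (W * (\<delta> / 2) powr (- (d/2))))"
    using \<delta> by (intro has_bochner_integral_add has_bochner_integral_mult_right i3 i0) auto
  have gW: "has_bochner_integral lborel g W"
    using i0[of 1] by (simp add: g_def)
  have u_meas: "u \<in> borel_measurable lborel"
    using rem(2) D3K \<epsilon> by (auto simp: u_def intro!: borel_measurable_continuous_onI continuous_intros)
  \<comment> \<open>The quadratic lower bound on \<open>I\<close> places \<open>u\<close> below a
    Gaussian with parameter \<delta>.\<close>
  have u_int: "integrable lborel u"
  proof (rule Bochner_Integration.integrable_bound[OF _ u_meas])
    show "integrable lborel (\<lambda>x. sqrt (Q x) ^ 0 * exp (- (\<delta> * (Q x / 2))))"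
      using i0[OF \<delta>(1)] by (rule integrable.intros)
    show "AE x in lborel. norm (u x) \<le> norm (sqrt (Q x) ^ 0 * exp (- (\<delta> * (Q x / 2))))"
      using low by (intro AE_I2) (simp add: u_def)
  qed
  have Z: "(\<integral>x. u x \<partial>lborel) > 0"
    by (rule integrable_lborel_pos_integral[OF u_int]) (simp add: u_def)
  have intg: "integrable lborel g" "(\<integral>x. g x \<partial>lborel) = W"
    using gW by (auto simp: has_bochner_integral_iff)

  have post: "posterior I \<epsilon> = density lborel (\<lambda>x. ennreal (1 / (\<integral>x. u x \<partial>lborel) * u x))"
    by (simp add: posterior_def u_def Let_def)
  have lapl: "laplace_approx I \<epsilon> xhat = density lborel (\<lambda>x. ennreal (g x / W))"
  proof -
    have "\<epsilon> *\<^sub>R laplace_cov I xhat = matrix_inv H'"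
      using matrix_inv_scaleR[OF posH, of "1 / \<epsilon>"] \<epsilon> by (simp add: H'_def H_def laplace_cov_def)
    then show ?thesis
      using gaussian_measure_matrix_inv[OF posH', of xhat]
      by (simp add: laplace_approx_def g_def Q_def W_def dn)
  qed
  have nonneg: "0 \<le> u x" "0 \<le> g x" for x
    by (simp_all add: u_def g_def)
  have "tv_dist (posterior I \<epsilon>) (laplace_approx I \<epsilon> xhat) \<le> (\<integral>x. \<bar>u x - g x\<bar> \<partial>lborel) / W"
    using tv_dist_density_le[OF u_int nonneg(1) intg(1) nonneg(2) Z, unfolded intg(2), OF W]
    unfolding post lapl .
  also have "(\<integral>x. \<bar>u x - g x\<bar> \<partial>lborel) \<le>
      exp 1 * \<kappa> / 6 * (W * (2 * sqrt 2) * \<Gamma>r) + exp (- S / 4) * (W * (\<delta> / 2) powr (- (d/2)))"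
    unfolding has_bochner_integral_integral_eq[OF B, symmetric]
    by (rule integral_mono[OF _ integrable.intros[OF B] bound]) (use u_int intg(1) in auto)
  also have "\<dots> = W * (a + exp (- S / 4) * (\<delta> / 2) powr (- (d/2)))"
    by (simp add: a_def C_def algebra_simps)
  also have "\<dots> \<le> W * (a + a)"
  proof -
    \<comment> \<open>The Gamma quotient in \<open>L\<close> is the reciprocal of
      \<open>\<Gamma>r\<close>, so the logarithm has the form required by the tail estimate.\<close>
    have "2 / (C * (1 + \<epsilon>) * \<epsilon> powr (1/2) * K * \<delta> powr (d/2)) * (Gamma (d/2) / Gamma (d/2 + 3/2)) =
        2 / (a * \<delta> powr (d/2))"
      by (simp add: a_def \<kappa>_def \<Gamma>r_def mult_ac)
    then have Leq: "L = ln (2 / (a * \<delta> powr (d/2)))" by (simp add: L_def)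
    have "exp (- S / 4) * (\<delta> / 2) powr (- (d/2)) \<le> a"
      using tail_bound[OF d \<delta>(1) \<kappa> a, folded Leq, unfolded \<kappa>_def, OF max_le]
      unfolding S_def \<kappa>_def .
    then show ?thesis using W by (intro mult_left_mono add_left_mono) auto
  qed
  finally have "tv_dist (posterior I \<epsilon>) (laplace_approx I \<epsilon> xhat) \<le> W * (a + a) / W"
    using W by (simp add: divide_right_mono)
  also have "\<dots> = 2 * C * (1 + \<epsilon>) * \<epsilon> powr (1/2) * K * (Gamma (d/2 + 3/2) / Gamma (d/2))"
    using W by (simp add: a_def \<kappa>_def \<Gamma>r_def)
  finally show ?thesis .
qed

end
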